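(* Let $\Omega\subseteq\mathbb{C}$ be an arbitrary open set and let $\mathcal{F}\subseteq\mathbb{N}\times\mathbb{N}$ contain a sequence $(\tilde p_n,\tilde q_n)\in\mathcal{F}$, $n=1,2,\dots$, with $\tilde p_n\to+\infty$ and $\tilde q_n\to+\infty$ as $n\to+\infty$. Then there exists a holomorphic function $f\in H(\Omega)$ with the following property: there exists a sequence $(p_n,q_n)_{n\in\mathbb{N}}$ in $\mathcal{F}$ such that for every compact $K\subseteq\Omega$ there is an $n(K)\in\mathbb{N}$ so that $f\in\mathcal{D}_{p_n,q_n}(\zeta)$ for all $n\ge n(K)$ and all $\zeta\in K$, and $\sup_{\zeta\in K}\sup_{z\in K}\big|[p_n/q_n]_{f,\zeta}(z)-f(z)\big|\to 0$ as $n\to+\infty$. Further, the set of all such functions $f\in H(\Omega)$ is $G_\delta$ and dense in $H(\Omega)$ endowed with the topology of uniform convergence on compacta.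
   Context: $H(\Omega)$ is the space of holomorphic functions on $\Omega$ with the topology of uniform convergence on compact subsets of $\Omega$. Padé approximants. Degrees $p,q$ range over $\mathbb{N}=\{0,1,2,\dots\}$. Let $f=\sum_{v\ge 0}a_v(z-\zeta)^v$ be a power series centered at $\zeta\in\mathbb{C}$ (for $f$ holomorphic near $\zeta$, its Taylor series at $\zeta$). A Padé approximant $[p/q]_{f,\zeta}$ is a rational function of the form $P/Q$, $P(z)=\sum_{v=0}^p n_v(z-\zeta)^v$, $Q(z)=\sum_{v=0}^q d_v(z-\zeta)^v$ with $d_0=1$, whose Taylor coefficients $b_v$ at $\zeta$ satisfy $b_v=a_v$ for $v=0,\dots,p+q$. We write $f\in\mathcal{D}_{p,q}(\zeta)$ if the Hankel determinant $\det\big(a_{p-q+i+j-1}\big)_{i,j=1}^q$ is nonzero, with $a_i=0$ for $i<0$ (for $q=0$ the condition is always satisfied). In that case $[p/q]_{f,\zeta}$ exists and is unique (for $q=0$ it is the Taylor partial sum $\sum_{v=0}^p a_v(z-\zeta)^v$). The value of a rational function at a pole is taken to be $\infty$, so a finite supremum over $K$ means that there are no poles in $K$. *)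

theory Defs
  imports
    "HOL-Complex_Analysis.Complex_Analysis"
    "Jordan_Normal_Form.Determinant"
begin

(* Extensionality makes each holomorphic function on \<Omega> correspond to exactly one element,
   since HOL functions also carry (irrelevant) values outside \<Omega>. *)
definition hol_space :: "complex set \<Rightarrow> (complex \<Rightarrow> complex) set" where
  "hol_space \<Omega> = {f. f holomorphic_on \<Omega>} \<inter> extensional \<Omega>"

(* The sets {g. \<forall>z\<in>K. dist (g z) (f z) < e} form a neighbourhood base at f. *)
definition hol_open :: "complex set \<Rightarrow> (complex \<Rightarrow> complex) set \<Rightarrow> bool" where
  "hol_open \<Omega> U \<longleftrightarrow> U \<subseteq> hol_space \<Omega> \<and>
     (\<forall>f\<in>U. \<exists>K e. compact K \<and> K \<subseteq> \<Omega> \<and> e > 0 \<and>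
        {g \<in> hol_space \<Omega>. \<forall>z\<in>K. dist (g z) (f z) < e} \<subseteq> U)"

definition hol_topology :: "complex set \<Rightarrow> (complex \<Rightarrow> complex) topology" where
  "hol_topology \<Omega> = topology (hol_open \<Omega>)"

lemma istopology_hol_open: "istopology (hol_open \<Omega>)"
  unfolding istopology_def
proof (intro conjI allI impI)
  fix S T assume S: "hol_open \<Omega> S" and T: "hol_open \<Omega> T"
  show "hol_open \<Omega> (S \<inter> T)"
    unfolding hol_open_def
  proof (intro conjI ballI)
    show "S \<inter> T \<subseteq> hol_space \<Omega>"
      using S by (auto simp: hol_open_def)
  next
    fix f assume f: "f \<in> S \<inter> T"
    obtain K d where K: "compact K" "K \<subseteq> \<Omega>" "d > 0"
      "{g \<in> hol_space \<Omega>. \<forall>z\<in>K. dist (g z) (f z) < d} \<subseteq> S"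
      using S f unfolding hol_open_def by blast
    obtain L e where L: "compact L" "L \<subseteq> \<Omega>" "e > 0"
      "{g \<in> hol_space \<Omega>. \<forall>z\<in>L. dist (g z) (f z) < e} \<subseteq> T"
      using T f unfolding hol_open_def by blast
    have "{g \<in> hol_space \<Omega>. \<forall>z\<in>K \<union> L. dist (g z) (f z) < min d e} \<subseteq> S \<inter> T"
      using K(4) L(4) by auto
    moreover have "compact (K \<union> L)" "K \<union> L \<subseteq> \<Omega>" "min d e > 0"
      using K(1-3) L(1-3) by (simp_all add: compact_Un)
    ultimately show "\<exists>K e. compact K \<and> K \<subseteq> \<Omega> \<and> e > 0 \<and>
        {g \<in> hol_space \<Omega>. \<forall>z\<in>K. dist (g z) (f z) < e} \<subseteq> S \<inter> T"
      by (intro exI[of _ "K \<union> L"] exI[of _ "min d e"] conjI)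
  qed
next
  fix \<U> assume \<U>: "\<forall>U\<in>\<U>. hol_open \<Omega> U"
  show "hol_open \<Omega> (\<Union>\<U>)"
    unfolding hol_open_def
  proof (intro conjI ballI)
    show "\<Union>\<U> \<subseteq> hol_space \<Omega>"
      using \<U> by (auto simp: hol_open_def)
  next
    fix f assume "f \<in> \<Union>\<U>"
    then obtain U where U: "U \<in> \<U>" "f \<in> U"
      by blast
    then have "hol_open \<Omega> U"
      using \<U> by blast
    then obtain K e where K: "compact K" "K \<subseteq> \<Omega>" "e > 0"
      "{g \<in> hol_space \<Omega>. \<forall>z\<in>K. dist (g z) (f z) < e} \<subseteq> U"
      using U(2) unfolding hol_open_def by blast
    have "{g \<in> hol_space \<Omega>. \<forall>z\<in>K. dist (g z) (f z) < e} \<subseteq> \<Union>\<U>"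
      using K(4) U(1) by (rule order_trans[OF _ Union_upper])
    with K(1-3) show "\<exists>K e. compact K \<and> K \<subseteq> \<Omega> \<and> e > 0 \<and>
        {g \<in> hol_space \<Omega>. \<forall>z\<in>K. dist (g z) (f z) < e} \<subseteq> \<Union>\<U>"
      by (intro exI[of _ K] exI[of _ e] conjI)
  qed
qed

lemma openin_hol_topology: "openin (hol_topology \<Omega>) U \<longleftrightarrow> hol_open \<Omega> U"
  by (simp add: hol_topology_def topology_inverse' istopology_hol_open)

lemma topspace_hol_topology: "topspace (hol_topology \<Omega>) = hol_space \<Omega>"
proof
  show "topspace (hol_topology \<Omega>) \<subseteq> hol_space \<Omega>"
    unfolding topspace_def by (auto simp: openin_hol_topology hol_open_def)
  have "hol_open \<Omega> (hol_space \<Omega>)"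
    unfolding hol_open_def
  proof (intro conjI ballI)
    fix f
    show "\<exists>K e. compact K \<and> K \<subseteq> \<Omega> \<and> e > 0 \<and>
        {g \<in> hol_space \<Omega>. \<forall>z\<in>K. dist (g z) (f z) < e} \<subseteq> hol_space \<Omega>"
      by (intro exI[of _ "{}"] exI[of _ "1::real"]) auto
  qed simp
  then show "hol_space \<Omega> \<subseteq> topspace (hol_topology \<Omega>)"
    by (intro openin_subset) (simp add: openin_hol_topology)
qed

(* The rational function z \<mapsto> P(z - \<zeta>) / Q(z - \<zeta>). By remove_sings, common zeros of P and Q
   are cancelled, so equal rational functions are equal as HOL functions; at a pole the HOL
   function has the dummy value 0, which approx_error below replaces by \<infinity>. *)
definition rational_at :: "complex \<Rightarrow> complex poly \<Rightarrow> complex poly \<Rightarrow> complex \<Rightarrow> complex" where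
  "rational_at \<zeta> P Q = remove_sings (\<lambda>z. poly P (z - \<zeta>) / poly Q (z - \<zeta>))"

definition is_pade :: "complex fps \<Rightarrow> complex \<Rightarrow> nat \<Rightarrow> nat \<Rightarrow> (complex \<Rightarrow> complex) \<Rightarrow> bool" where
  "is_pade a \<zeta> p q R \<longleftrightarrow>
     (\<exists>P Q. Polynomial.degree P \<le> p \<and> Polynomial.degree Q \<le> q \<and> Polynomial.coeff Q 0 = 1 \<and>
        R = rational_at \<zeta> P Q \<and>
        (\<forall>v\<le>p + q. fps_nth (fps_expansion R \<zeta>) v = fps_nth a v))"

definition pade :: "complex fps \<Rightarrow> complex \<Rightarrow> nat \<Rightarrow> nat \<Rightarrow> complex \<Rightarrow> complex" where
  "pade a \<zeta> p q = (THE R. is_pade a \<zeta> p q R)"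

definition fps_nth_int :: "complex fps \<Rightarrow> int \<Rightarrow> complex" where
  "fps_nth_int a i = (if i < 0 then 0 else fps_nth a (nat i))"

(* Matrix indices start at 0 here, so the index p - q + i + j - 1 with i, j = 1, \<dots>, q
   becomes p - q + i + j + 1 with i, j = 0, \<dots>, q - 1. *)
definition hankel_mat :: "complex fps \<Rightarrow> nat \<Rightarrow> nat \<Rightarrow> complex Matrix.mat" where
  "hankel_mat a p q =
     Matrix.mat q q (\<lambda>(i, j). fps_nth_int a (int p - int q + int i + int j + 1))"

(* For q = 0 the determinant of the empty matrix is 1, so the condition always holds. *)
definition pade_regular :: "complex fps \<Rightarrow> nat \<Rightarrow> nat \<Rightarrow> bool" where
  "pade_regular a p q \<longleftrightarrow> Determinant.det (hankel_mat a p q) \<noteq> 0"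

definition approx_error :: "(complex \<Rightarrow> complex) \<Rightarrow> (complex \<Rightarrow> complex) \<Rightarrow> complex \<Rightarrow> ennreal" where
  "approx_error R f z = (if is_pole R z then \<infinity> else ennreal (cmod (R z - f z)))"

definition pade_universal :: "(nat \<times> nat) set \<Rightarrow> complex set \<Rightarrow> (complex \<Rightarrow> complex) \<Rightarrow> bool" where
  "pade_universal F \<Omega> f \<longleftrightarrow>
     (\<exists>p q :: nat \<Rightarrow> nat. (\<forall>n. (p n, q n) \<in> F) \<and>
        (\<forall>K. compact K \<and> K \<subseteq> \<Omega> \<longrightarrow>
           (\<exists>N. \<forall>n\<ge>N. \<forall>\<zeta>\<in>K. pade_regular (fps_expansion f \<zeta>) (p n) (q n)) \<and>
           (\<lambda>n. SUP \<zeta>\<in>K. SUP z\<in>K. approx_error (pade (fps_expansion f \<zeta>) \<zeta> (p n) (q n)) f z)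
             \<longlonglongrightarrow> 0))"

end

theory Submission
  imports Defs "HOL-Computational_Algebra.Field_as_Ring"
begin

text \<open>
  By Runge's theorem every element of \<open>H(\<Omega>)\<close> is, on compact sets, a uniform limit of rational
  functions \<open>P/Q\<close> with poles off \<open>\<Omega>\<close>. Adding a small multiple of \<open>z ^ (p - deg Q)\<close> makes the
  numerator have degree exactly \<open>p\<close>, and a reduced fraction of this form with \<open>deg Q \<le> q\<close> lies in
  \<open>D_{p,q}(\<zeta>)\<close> and equals its own Pade approximant \<open>[p/q]\<close> about every point \<open>\<zeta> \<in> \<Omega>\<close>.
  On the other hand, by Cramer's rule numerator and denominator of the approximant depend continuously
  on finitely many Taylor coefficients of \<open>f\<close>, so that being uniformly \<open>s\<close>-close to its
  \<open>[p/q]\<close> approximants on a compact set is an open condition on \<open>f\<close>. Universality is a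
  countable intersection of unions of such conditions, each union being open and dense, and Baire
  category applies.
\<close>

section \<open>Cauchy integrals over a grid\<close>

text \<open>A reduced fraction with numerator of degree below \<open>p\<close> and denominator of
  degree below \<open>q\<close> is never in D_{p,q}. Runge's theorem fixes the denominator while
  \<open>q\<close> is dictated by \<open>F\<close>, so the numerator has to be given the exact
  degree. Degree and coprimality are invariant under translation, hence regularity holds at all
  centres at once. Large \<open>q\<close> leaves room for the denominator, large \<open>p\<close>
  for a monomial that dominates the numerator. For openness the obstacle is that poles belong to the
  reduced fraction, whereas continuity is available for the determinant formulas, which are not
  reduced by construction. Regularity forces numerator and denominator in these formulas to have no
  common root, so that poles and zeros of the denominator agree. Centre and evaluation point move as
  well, and are handled by compactness of the set of such pairs. Grid squares give a Cauchy formula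
  on an arbitrary compact set from rectangles alone, and the shape of the exhausting compact sets
  lets each pole leave \<Omega> in a single move.\<close>

definition grid_pt :: "real \<Rightarrow> int \<Rightarrow> int \<Rightarrow> complex" where
  "grid_pt d i j = Complex (d * of_int i) (d * of_int j)"

definition grid_sq :: "real \<Rightarrow> int \<times> int \<Rightarrow> complex set" where
  "grid_sq d s = cbox (grid_pt d (fst s) (snd s)) (grid_pt d (fst s + 1) (snd s + 1))"

text \<open>Each edge is indexed by the square of which it is the bottom edge (or, for
  \<open>ver_int\<close>, the left edge) and is oriented rightwards or upwards. Opposite edges of a
  square then differ by a shift of the index, so cancellation of shared edges becomes a statement
  about shifted index sets.\<close>

definition hor_int :: "real \<Rightarrow> (complex \<Rightarrow> complex) \<Rightarrow> int \<times> int \<Rightarrow> complex" where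
  "hor_int d g s = contour_integral (linepath (grid_pt d (fst s) (snd s)) (grid_pt d (fst s + 1) (snd s))) g"

definition ver_int :: "real \<Rightarrow> (complex \<Rightarrow> complex) \<Rightarrow> int \<times> int \<Rightarrow> complex" where
  "ver_int d g s = contour_integral (linepath (grid_pt d (fst s) (snd s)) (grid_pt d (fst s) (snd s + 1))) g"

lemma mem_grid_sq:
  "z \<in> grid_sq d s \<longleftrightarrow> d * of_int (fst s) \<le> Re z \<and> Re z \<le> d * of_int (fst s + 1) \<and>
     d * of_int (snd s) \<le> Im z \<and> Im z \<le> d * of_int (snd s + 1)"
  by (auto simp: grid_sq_def grid_pt_def in_cbox_complex_iff)

lemma mem_interior_grid_sq:
  "z \<in> interior (grid_sq d s) \<longleftrightarrow> d * of_int (fst s) < Re z \<and> Re z < d * of_int (fst s + 1) \<and>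
     d * of_int (snd s) < Im z \<and> Im z < d * of_int (snd s + 1)"
  by (auto simp: grid_sq_def grid_pt_def in_box_complex_iff interior_cbox)

lemma interior_grid_sq_unique:
  assumes "d > 0" "z \<in> interior (grid_sq d s)" "z \<in> grid_sq d t"
  shows "s = t"
proof -
  have "d * of_int (fst s) < d * of_int (fst t + 1)" "d * of_int (fst t) < d * of_int (fst s + 1)"
    "d * of_int (snd s) < d * of_int (snd t + 1)" "d * of_int (snd t) < d * of_int (snd s + 1)"
    using assms(2,3) by (auto simp: mem_interior_grid_sq mem_grid_sq)
  then have "of_int (fst s) < (of_int (fst t + 1) :: real)" "of_int (fst t) < (of_int (fst s + 1) :: real)"
    "of_int (snd s) < (of_int (snd t + 1) :: real)" "of_int (snd t) < (of_int (snd s + 1) :: real)"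
    using assms(1) by (simp_all only: mult_less_cancel_left_pos)
  then have "fst s = fst t" "snd s = snd t"
    by linarith+
  then show ?thesis
    by (rule prod_eqI)
qed

lemma convex_grid_sq: "convex (grid_sq d s)"
  by (simp add: grid_sq_def)

lemma grid_segment_subset:
  assumes "d > 0"
  shows "closed_segment (grid_pt d i j) (grid_pt d (i + 1) j) \<subseteq> grid_sq d (i, j) \<inter> grid_sq d (i, j - 1)"
    and "closed_segment (grid_pt d i j) (grid_pt d i (j + 1)) \<subseteq> grid_sq d (i, j) \<inter> grid_sq d (i - 1, j)"
  using assms
  by (intro closed_segment_subset convex_Int convex_grid_sq;
      auto simp: mem_grid_sq grid_pt_def algebra_simps)+

lemma contour_integral_grid_sq:
  assumes d: "d > 0" and g: "continuous_on (grid_sq d (i, j) - interior (grid_sq d (i, j))) g"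
  shows "contour_integral (rectpath (grid_pt d i j) (grid_pt d (i + 1) (j + 1))) g =
    hor_int d g (i, j) - hor_int d g (i, j + 1) + (ver_int d g (i + 1, j) - ver_int d g (i, j))"
proof -
  let ?a = "grid_pt d i j" and ?b = "grid_pt d (i+1) j" and ?c = "grid_pt d (i+1) (j+1)" and ?e = "grid_pt d i (j+1)"
  have corners: "Complex (Re ?c) (Im ?a) = ?b" "Complex (Re ?a) (Im ?c) = ?e"
    by (auto simp: grid_pt_def)
  have le: "Re ?a \<le> Re ?c" "Im ?a \<le> Im ?c"
    using d by (auto simp: grid_pt_def algebra_simps)
  have img: "path_image (rectpath ?a ?c) = grid_sq d (i, j) - interior (grid_sq d (i, j))"
    using path_image_rectpath_cbox_minus_box[OF le] by (simp add: grid_sq_def interior_cbox)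
  have img2: "path_image (rectpath ?a ?c) = closed_segment ?a ?b \<union> closed_segment ?b ?c \<union> closed_segment ?c ?e \<union> closed_segment ?e ?a"
    by (auto simp: rectpath_def Let_def corners path_image_join)
  have c: "continuous_on (closed_segment ?a ?b) g" "continuous_on (closed_segment ?b ?c) g"
    "continuous_on (closed_segment ?c ?e) g" "continuous_on (closed_segment ?e ?a) g"
    using g img img2 by (metis Un_upper1 Un_upper2 continuous_on_subset le_supI1)+
  note ci = c[THEN contour_integrable_continuous_linepath]
  have "contour_integral (rectpath ?a ?c) g = contour_integral (linepath ?a ?b) g + (contour_integral (linepath ?b ?c) g
     + (contour_integral (linepath ?c ?e) g + contour_integral (linepath ?e ?a) g))"
    unfolding rectpath_def Let_def corners using ci by simp
  also have "contour_integral (linepath ?c ?e) g = - contour_integral (linepath ?e ?c) g"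
    using c(3) by (rule contour_integral_reverse_linepath)
  also have "contour_integral (linepath ?e ?a) g = - contour_integral (linepath ?a ?e) g"
    using c(4) by (rule contour_integral_reverse_linepath)
  finally show ?thesis
    by (simp add: hor_int_def ver_int_def)
qed

text \<open>Differentiation under the integral sign. Continuity is what carries the grid formula
  from the interiors of the squares to points lying on grid lines.\<close>

lemma isCont_Cauchy_integral_linepath:
  assumes "continuous_on (closed_segment a b) f" "z \<notin> closed_segment a b"
  shows "isCont (\<lambda>z. contour_integral (linepath a b) (\<lambda>w. f w / (w - z))) z"
proof -
  have "(\<lambda>z. contour_integral (linepath a b) (\<lambda>w. f w / (w - z))) field_differentiable at z"
  proof -
    have "((\<lambda>u. f u / (u - w) ^ 1) has_contour_integral contour_integral (linepath a b) (\<lambda>u. f u / (u - w))) (linepath a b)"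
      if "w \<in> UNIV - path_image (linepath a b)" for w
      using that assms
      by (auto intro!: has_contour_integral_integral contour_integrable_continuous_linepath continuous_intros)
    moreover have "norm (vector_derivative (linepath a b) (at t)) \<le> norm (b - a)" for t
      by simp
    ultimately have "((\<lambda>z. contour_integral (linepath a b) (\<lambda>w. f w / (w - z))) has_field_derivative
         of_nat 1 * contour_integral (linepath a b) (\<lambda>u. f u / (u - z) ^ Suc 1)) (at z)"
      using assms
      by (intro Cauchy_next_derivative[where S = UNIV and B = "norm (b - a)"]) auto
    then show ?thesis
      by (auto simp: field_differentiable_def)
  qed
  then show ?thesis
    by (rule field_differentiable_imp_continuous_at)
qed

text \<open>For a shift \<open>s\<close> of squares and edge integrals \<open>h\<close>, an edge
  between two squares of \<open>M\<close> occurs twice with opposite signs. What remains are the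
  edges with exactly one neighbour in \<open>M\<close>.\<close>

lemma sum_diff_image:
  fixes h :: "'a \<Rightarrow> 'b::ab_group_add"
  assumes "finite M" "inj_on s M"
  shows "(\<Sum>x\<in>M. h x - h (s x)) = (\<Sum>x\<in>M - s ` M. h x) - (\<Sum>x\<in>s ` M - M. h x)"
proof -
  have "(\<Sum>x\<in>M. h x - h (s x)) = sum h M - sum h (s ` M)"
    using assms(2) by (simp add: sum_subtractf sum.reindex)
  also have "sum h M = sum h (M - s ` M) + sum h (M \<inter> s ` M)"
    using assms(1) by (metis sum.Int_Diff add.commute)
  also have "sum h (s ` M) = sum h (s ` M - M) + sum h (s ` M \<inter> M)"
    using assms(1) by (metis sum.Int_Diff add.commute finite_imageI)
  finally show ?thesis
    by (simp add: Int_commute)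
qed

lemma finite_grid_sq_meeting:
  assumes "d > 0" "bounded K"
  shows "finite {s. grid_sq d s \<inter> K \<noteq> {}}"
proof -
  obtain B where B: "\<And>z. z \<in> K \<Longrightarrow> norm z \<le> B"
    using assms(2) by (auto simp: bounded_iff)
  \<comment> \<open>The extra 1 is for the lower bound: a square is indexed by its lower left
    corner, and only its upper right corner is known to be at least \<open>-B\<close>.\<close>
  define N where "N = \<lceil>B / d\<rceil> + 1"
  have "B / d \<le> of_int N - 1"
    unfolding N_def by linarith
  then have N: "B \<le> d * (of_int N - 1)"
    using assms(1) by (simp add: field_simps)
  have "s \<in> {-N..N} \<times> {-N..N}" if "z \<in> grid_sq d s" "z \<in> K" for s z
  proof -
    have "\<bar>Re z\<bar> \<le> B" "\<bar>Im z\<bar> \<le> B"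
      using B[OF that(2)] abs_Re_le_cmod[of z] abs_Im_le_cmod[of z] by linarith+
    with that(1) N have "d * of_int (fst s) \<le> d * of_int (N - 1)" "d * of_int (-N) \<le> d * of_int (fst s)"
       "d * of_int (snd s) \<le> d * of_int (N - 1)" "d * of_int (-N) \<le> d * of_int (snd s)"
      by (auto simp: mem_grid_sq algebra_simps)
    then have "fst s \<le> N - 1" "-N \<le> fst s" "snd s \<le> N - 1" "-N \<le> snd s"
      using assms(1) by (simp_all only: mult_le_cancel_left_pos of_int_le_iff)
    then show ?thesis
      by (cases s) auto
  qed
  then have "{s. grid_sq d s \<inter> K \<noteq> {}} \<subseteq> {-N..N} \<times> {-N..N}"
    by blast
  then show ?thesis
    by (rule finite_subset) simp
qed

lemma ex_grid_sq:
  assumes "d > 0"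
  shows "\<exists>s. z \<in> grid_sq d s"
proof
  have "d * of_int \<lfloor>x / d\<rfloor> \<le> x" "x \<le> d * of_int (\<lfloor>x / d\<rfloor> + 1)" for x
  proof -
    have "of_int \<lfloor>x / d\<rfloor> \<le> x / d" "x / d \<le> of_int (\<lfloor>x / d\<rfloor> + 1)"
      by linarith+
    then show "d * of_int \<lfloor>x / d\<rfloor> \<le> x" "x \<le> d * of_int (\<lfloor>x / d\<rfloor> + 1)"
      using assms by (simp_all only: pos_le_divide_eq pos_divide_le_eq mult.commute)
  qed
  then show "z \<in> grid_sq d (\<lfloor>Re z / d\<rfloor>, \<lfloor>Im z / d\<rfloor>)"
    by (simp add: mem_grid_sq)
qed

lemma grid_sq_dist:
  assumes "z \<in> grid_sq d s" "w \<in> grid_sq d s"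
  shows "dist z w \<le> 2 * d"
proof -
  have "norm (z - w) \<le> \<bar>Re (z - w)\<bar> + \<bar>Im (z - w)\<bar>"
    by (rule cmod_le)
  also have "\<dots> \<le> d + d"
    using assms by (intro add_mono) (auto simp: mem_grid_sq algebra_simps)
  finally show ?thesis
    by (simp add: dist_norm)
qed

text \<open>The square around \<open>z\<close> contributes by Cauchy's formula with winding number
  1. Every other square does not contain \<open>z\<close>, so Cauchy's theorem gives 0 there. An
  interior \<open>z\<close> keeps the kernel continuous on all edges.\<close>

lemma sum_contour_integral_grid_sq:
  assumes d: "d > 0" and M: "finite M" and f: "f holomorphic_on S" and sub: "\<And>s. s \<in> M \<Longrightarrow> grid_sq d s \<subseteq> S"
    and s: "s \<in> M" "z \<in> interior (grid_sq d s)"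
  defines "g \<equiv> \<lambda>w. f w / (w - z)"
  shows "2 * pi * \<i> * f z =
    (\<Sum>t\<in>M. hor_int d g t - hor_int d g (fst t, snd t + 1)) - (\<Sum>t\<in>M. ver_int d g t - ver_int d g (fst t + 1, snd t))"
proof -
  let ?r = "\<lambda>t. contour_integral (rectpath (grid_pt d (fst t) (snd t)) (grid_pt d (fst t + 1) (snd t + 1))) g"
  have le: "Re (grid_pt d i j) \<le> Re (grid_pt d (i + 1) (j + 1))" "Im (grid_pt d i j) \<le> Im (grid_pt d (i + 1) (j + 1))" for i j
    using d by (auto simp: grid_pt_def algebra_simps)
  have img: "path_image (rectpath (grid_pt d i j) (grid_pt d (i+1) (j+1))) = grid_sq d (i, j) - interior (grid_sq d (i, j))" for i j
    using path_image_rectpath_cbox_minus_box[OF le] by (simp add: grid_sq_def interior_cbox)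
  have f': "f holomorphic_on grid_sq d t" if "t \<in> M" for t
    using f sub[OF that] by (rule holomorphic_on_subset)
  have "?r t = (if t = s then 2 * pi * \<i> * f z else 0)" if t: "t \<in> M" for t
  proof (cases "t = s")
    case True
    have "((\<lambda>w. f w / (w - z)) has_contour_integral 2 * pi * \<i> * winding_number
        (rectpath (grid_pt d (fst s) (snd s)) (grid_pt d (fst s + 1) (snd s + 1))) z * f z)
        (rectpath (grid_pt d (fst s) (snd s)) (grid_pt d (fst s + 1) (snd s + 1)))"
      using s(2) img[of "fst s" "snd s"]
      by (intro Cauchy_integral_formula_convex_simple[OF convex_grid_sq f'[OF s(1)]]) auto
    moreover have "winding_number (rectpath (grid_pt d (fst s) (snd s)) (grid_pt d (fst s + 1) (snd s + 1))) z = 1"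
      using s(2) by (intro winding_number_rectpath) (simp add: grid_sq_def interior_cbox)
    ultimately show ?thesis
      using True by (simp add: g_def contour_integral_unique)
  next
    case False
    then have z: "z \<notin> grid_sq d t"
      using interior_grid_sq_unique[OF d s(2)] by blast
    have "g holomorphic_on grid_sq d t"
      unfolding g_def using z f'[OF t] by (intro holomorphic_intros) auto
    then have "(g has_contour_integral 0) (rectpath (grid_pt d (fst t) (snd t)) (grid_pt d (fst t + 1) (snd t + 1)))"
      using img[of "fst t" "snd t"] by (intro Cauchy_theorem_convex_simple[OF _ convex_grid_sq]) auto
    then show ?thesis
      using False by (simp add: contour_integral_unique)
  qed
  then have "2 * pi * \<i> * f z = (\<Sum>t\<in>M. ?r t)"
    using M s(1) by simp
  also have "\<dots> = (\<Sum>t\<in>M. hor_int d g t - hor_int d g (fst t, snd t + 1) + (ver_int d g (fst t + 1, snd t) - ver_int d g t))"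
  proof (rule sum.cong[OF refl])
    fix t assume t: "t \<in> M"
    have "continuous_on (grid_sq d t - interior (grid_sq d t)) g"
    proof -
      have "z \<notin> grid_sq d t - interior (grid_sq d t)"
        using interior_grid_sq_unique[OF d s(2)] s(2) by blast
      then show ?thesis
        unfolding g_def using f'[OF t]
        by (intro continuous_intros continuous_on_subset[OF holomorphic_on_imp_continuous_on[OF f'[OF t]]]) auto
    qed
    then show "?r t = hor_int d g t - hor_int d g (fst t, snd t + 1) + (ver_int d g (fst t + 1, snd t) - ver_int d g t)"
      using contour_integral_grid_sq[OF d, of "fst t" "snd t"] by simp
  qed
  finally show ?thesis
    by (simp add: sum.distrib sum_subtractf)
qed

text \<open>
  In the sum of Cauchy integrals over the squares meeting \<open>K\<close>, edges shared by two such squares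
  cancel, and an edge of only one of them misses \<open>K\<close>.
\<close>
lemma grid_decomposition_induct:
  fixes f :: "complex \<Rightarrow> complex" and A :: "(complex \<Rightarrow> complex) \<Rightarrow> bool"
  assumes "open S" and K: "compact K" "K \<subseteq> S" and f: "f holomorphic_on S"
    and seg: "\<And>a b. closed_segment a b \<subseteq> S - K \<Longrightarrow> A (\<lambda>z. contour_integral (linepath a b) (\<lambda>w. f w / (w - z)))"
    and zero: "A (\<lambda>z. 0)" and add: "\<And>g h. A g \<Longrightarrow> A h \<Longrightarrow> A (\<lambda>z. g z + h z)"
    and scale: "\<And>c g. A g \<Longrightarrow> A (\<lambda>z. c * g z)"
    and cong: "\<And>g h. A g \<Longrightarrow> (\<And>z. z \<in> K \<Longrightarrow> g z = h z) \<Longrightarrow> A h"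
  shows "A f"
proof -
  obtain e where e: "e > 0" "(\<Union>x\<in>K. cball x e) \<subseteq> S"
    using compact_subset_open_imp_cball_epsilon_subset[OF K(1) assms(1) K(2)] by blast
  \<comment> \<open>The diameter of a square is at most \<open>2 * d\<close>, so the squares meeting
    \<open>K\<close> stay within distance \<open>e\<close> of \<open>K\<close> and hence inside
    \<open>S\<close>.\<close>
  define d where "d = e / 2"
  have d: "d > 0"
    using e by (simp add: d_def)
  define M where "M = {s. grid_sq d s \<inter> K \<noteq> {}}"
  have finM: "finite M"
    unfolding M_def using d K(1) by (intro finite_grid_sq_meeting compact_imp_bounded)
  have MS: "grid_sq d s \<subseteq> S" if s: "s \<in> M" for s
  proof
    fix z assume z: "z \<in> grid_sq d s"
    obtain w where w: "w \<in> grid_sq d s" "w \<in> K"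
      using s by (auto simp: M_def)
    then have "z \<in> cball w e"
      using grid_sq_dist[OF w(1) z] by (simp add: d_def)
    then show "z \<in> S"
      using e(2) w(2) by blast
  qed
  define up where "up = (\<lambda>s :: int \<times> int. (fst s, snd s + 1))"
  define right where "right = (\<lambda>s :: int \<times> int. (fst s + 1, snd s))"
  define F where "F = (\<lambda>z w. f w / (w - z))"
  \<comment> \<open>This is what survives the cancellation. All its edges avoid \<open>K\<close>, so
    it is continuous at every point of \<open>K\<close>, even where a cancelled edge passes through
    that point.\<close>
  define R where "R = (\<lambda>z. ((\<Sum>t\<in>M - up ` M. hor_int d (F z) t) - (\<Sum>t\<in>up ` M - M. hor_int d (F z) t))
    - ((\<Sum>t\<in>M - right ` M. ver_int d (F z) t) - (\<Sum>t\<in>right ` M - M. ver_int d (F z) t)))"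
  have mem_up: "t \<in> up ` M \<longleftrightarrow> (fst t, snd t - 1) \<in> M" for t
    by (force simp: up_def image_iff)
  have mem_right: "t \<in> right ` M \<longleftrightarrow> (fst t - 1, snd t) \<in> M" for t
    by (force simp: right_def image_iff)
  have inj: "inj_on up M" "inj_on right M"
    by (auto simp: inj_on_def up_def right_def prod_eq_iff)
  have mem_M: "t \<in> M \<longleftrightarrow> grid_sq d t \<inter> K \<noteq> {}" for t
    by (simp add: M_def)
  have segment: "X \<subseteq> S - K"
    if "X \<subseteq> grid_sq d s \<inter> grid_sq d t" "s \<in> M \<and> t \<notin> M \<or> s \<notin> M \<and> t \<in> M" for X s t
    using that MS[of s] MS[of t] unfolding mem_M by blast
  have hor: "closed_segment (grid_pt d (fst t) (snd t)) (grid_pt d (fst t + 1) (snd t)) \<subseteq> S - K"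
    if "t \<in> M - up ` M \<or> t \<in> up ` M - M" for t
    using that grid_segment_subset(1)[OF d, of "fst t" "snd t"] unfolding Diff_iff mem_up
    by (intro segment[of _ t "(fst t, snd t - 1)"]) auto
  have ver: "closed_segment (grid_pt d (fst t) (snd t)) (grid_pt d (fst t) (snd t + 1)) \<subseteq> S - K"
    if "t \<in> M - right ` M \<or> t \<in> right ` M - M" for t
    using that grid_segment_subset(2)[OF d, of "fst t" "snd t"] unfolding Diff_iff mem_right
    by (intro segment[of _ t "(fst t - 1, snd t)"]) auto
  have contf: "continuous_on S f"
    using f by (rule holomorphic_on_imp_continuous_on)
  have seg_cont: "isCont (\<lambda>z. contour_integral (linepath a b) (F z)) z"
    if "closed_segment a b \<subseteq> S - K" "z \<in> K" for a b z
    unfolding F_def using that continuous_on_subset[OF contf]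
    by (intro isCont_Cauchy_integral_linepath) auto
  have Rcont: "isCont R z" if "z \<in> K" for z
    unfolding R_def hor_int_def ver_int_def
    using that by (intro continuous_intros seg_cont hor ver) auto
  have int: "2 * pi * \<i> * f z = R z" if "s \<in> M" "z \<in> interior (grid_sq d s)" for s z
  proof -
    have "2 * pi * \<i> * f z =
      (\<Sum>t\<in>M. hor_int d (F z) t - hor_int d (F z) (up t)) - (\<Sum>t\<in>M. ver_int d (F z) t - ver_int d (F z) (right t))"
      using sum_contour_integral_grid_sq[OF d finM f MS that] by (simp add: F_def up_def right_def)
    then show ?thesis
      by (simp only: sum_diff_image[OF finM inj(1)] sum_diff_image[OF finM inj(2)] R_def)
  qed
  \<comment> \<open>A point of \<open>K\<close> on a grid line is a limit of interior points of an
    adjacent square, and both sides are continuous there.\<close>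
  have eq: "2 * pi * \<i> * f z = R z" if z: "z \<in> K" for z
  proof -
    obtain s where s: "z \<in> grid_sq d s"
      using ex_grid_sq[OF d] by blast
    with z have sM: "s \<in> M"
      by (auto simp: M_def)
    have "interior (grid_sq d s) \<noteq> {}"
    proof -
      have "Complex (d * (of_int (fst s) + 1/2)) (d * (of_int (snd s) + 1/2)) \<in> interior (grid_sq d s)"
        using d by (auto simp: mem_interior_grid_sq algebra_simps)
      then show ?thesis
        by blast
    qed
    then have "closure (interior (grid_sq d s)) = closure (grid_sq d s)"
      by (intro convex_closure_interior convex_grid_sq)
    then have "z \<in> closure (interior (grid_sq d s))"
      using s closure_subset by blast
    then obtain u where u: "\<And>n. u n \<in> interior (grid_sq d s)" "u \<longlonglongrightarrow> z"
      unfolding closure_sequential by blast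
    have "isCont f z"
      using contf z K(2) assms(1) by (simp add: continuous_on_eq_continuous_at subset_iff)
    then have "isCont (\<lambda>z. 2 * pi * \<i> * f z - R z) z"
      using Rcont[OF z] by (intro continuous_intros)
    then have "(\<lambda>n. 2 * pi * \<i> * f (u n) - R (u n)) \<longlonglongrightarrow> 2 * pi * \<i> * f z - R z"
      using u(2) by (rule isCont_tendsto_compose)
    moreover have "(\<lambda>n. 2 * pi * \<i> * f (u n) - R (u n)) = (\<lambda>n. 0)"
      using int[OF sM u(1)] by simp
    ultimately show ?thesis
      by (simp add: LIMSEQ_const_iff)
  qed
  have A_sum: "A (\<lambda>z. \<Sum>t\<in>T. h t z)" if "finite T" "\<And>t. t \<in> T \<Longrightarrow> A (h t)" for T :: "(int \<times> int) set" and h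
    using that by (induction T rule: finite_induct) (auto intro: zero add)
  have A_diff: "A (\<lambda>z. g z - h z)" if "A g" "A h" for g h
    using add[OF that(1) scale[OF that(2), of "-1"]] by simp
  have A_hor: "A (\<lambda>z. hor_int d (F z) t)" if "t \<in> M - up ` M \<or> t \<in> up ` M - M" for t
    unfolding hor_int_def F_def by (rule seg[OF hor[OF that]])
  have A_ver: "A (\<lambda>z. ver_int d (F z) t)" if "t \<in> M - right ` M \<or> t \<in> right ` M - M" for t
    unfolding ver_int_def F_def by (rule seg[OF ver[OF that]])
  have fin: "finite (M - T)" "finite (h ` M - M)" for T and h :: "int \<times> int \<Rightarrow> int \<times> int"
    using finM by auto
  have "A R"
    unfolding R_def
    by (rule A_diff[OF A_diff[OF A_sum[OF fin(1) A_hor] A_sum[OF fin(2) A_hor]]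
          A_diff[OF A_sum[OF fin(1) A_ver] A_sum[OF fin(2) A_ver]]]) blast+
  then have "A (\<lambda>z. 1 / (2 * pi * \<i>) * R z)"
    by (rule scale)
  then show ?thesis
    by (rule cong) (simp add: eq[symmetric])
qed

section \<open>Runge approximation\<close>

definition unif_closure :: "complex set \<Rightarrow> (complex \<Rightarrow> complex) set \<Rightarrow> (complex \<Rightarrow> complex) \<Rightarrow> bool" where
  "unif_closure K R f \<longleftrightarrow> (\<forall>e>0. \<exists>r\<in>R. \<forall>z\<in>K. dist (f z) (r z) \<le> e)"

text \<open>Idempotence of uniform closure. It allows approximants that are themselves only
  approximable, such as Riemann sums of Cauchy kernels whose poles still have to be moved.\<close>

lemma unif_closureI:
  assumes "\<And>e. e > 0 \<Longrightarrow> \<exists>g. unif_closure K R g \<and> (\<forall>z\<in>K. dist (f z) (g z) \<le> e)"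
  shows "unif_closure K R f"
  unfolding unif_closure_def
proof (intro allI impI)
  fix e :: real assume "e > 0"
  then have e: "e / 2 > 0"
    by simp
  then obtain g where g: "unif_closure K R g" "\<forall>z\<in>K. dist (f z) (g z) \<le> e / 2"
    using assms by blast
  from g(1) e obtain r where r: "r \<in> R" "\<forall>z\<in>K. dist (g z) (r z) \<le> e / 2"
    unfolding unif_closure_def by blast
  have "dist (f z) (r z) \<le> e" if "z \<in> K" for z
    using g(2) r(2) that dist_triangle[of "f z" "r z" "g z"] by fastforce
  with r(1) show "\<exists>r\<in>R. \<forall>z\<in>K. dist (f z) (r z) \<le> e"
    by blast
qed

lemma unif_closure_base: "f \<in> R \<Longrightarrow> unif_closure K R f"
  unfolding unif_closure_def by (intro allI impI bexI[of _ f]) auto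

lemma unif_closure_cong:
  assumes "unif_closure K R f" "\<And>z. z \<in> K \<Longrightarrow> f z = g z"
  shows "unif_closure K R g"
  using assms unfolding unif_closure_def by auto

lemma unif_closure_add:
  assumes "\<And>f g. f \<in> R \<Longrightarrow> g \<in> R \<Longrightarrow> (\<lambda>z. f z + g z) \<in> R" and f: "unif_closure K R f" and g: "unif_closure K R g"
  shows "unif_closure K R (\<lambda>z. f z + g z)"
  unfolding unif_closure_def
proof (intro allI impI)
  fix e :: real assume e: "e > 0"
  obtain r where r: "r \<in> R" "\<forall>z\<in>K. dist (f z) (r z) \<le> e / 2"
    using f e unfolding unif_closure_def by (meson half_gt_zero)
  obtain s where s: "s \<in> R" "\<forall>z\<in>K. dist (g z) (s z) \<le> e / 2"
    using g e unfolding unif_closure_def by (meson half_gt_zero)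
  have le: "dist (f z + g z) (r z + s z) \<le> e" if "z \<in> K" for z
    using r(2) s(2) that dist_triangle_add[of "f z" "g z" "r z" "s z"] by fastforce
  show "\<exists>r\<in>R. \<forall>z\<in>K. dist (f z + g z) (r z) \<le> e"
    by (intro bexI[OF _ assms(1)[OF r(1) s(1)]] ballI le)
qed

lemma unif_closure_scale:
  assumes "\<And>f. f \<in> R \<Longrightarrow> (\<lambda>z. c * f z) \<in> R" and f: "unif_closure K R f"
  shows "unif_closure K R (\<lambda>z. c * f z)"
  unfolding unif_closure_def
proof (intro allI impI)
  fix e :: real assume e: "e > 0"
  have pos: "norm c + 1 > 0"
    by (simp add: add_nonneg_pos)
  obtain r where r: "r \<in> R" "\<forall>z\<in>K. dist (f z) (r z) \<le> e / (norm c + 1)"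
    using f e pos unfolding unif_closure_def by (meson divide_pos_pos)
  have le: "dist (c * f z) (c * r z) \<le> e" if "z \<in> K" for z
  proof -
    have "dist (c * f z) (c * r z) = norm c * dist (f z) (r z)"
      by (simp add: dist_norm norm_mult flip: right_diff_distrib)
    also have "\<dots> \<le> (norm c + 1) * (e / (norm c + 1))"
      using r(2) that pos by (intro mult_mono) auto
    also have "\<dots> = e"
      using pos by simp
    finally show ?thesis .
  qed
  show "\<exists>r\<in>R. \<forall>z\<in>K. dist (c * f z) (r z) \<le> e"
    by (intro bexI[OF _ assms(1)[OF r(1)]] ballI le)
qed

section \<open>Riemann sums of Cauchy integrals\<close>

lemma norm_integral_Riemann_sum_le:
  fixes h :: "real \<Rightarrow> 'a::banach"
  assumes h: "continuous_on {0..1} h" and "n > 0"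
    and close: "\<And>s t. s \<in> {0..1} \<Longrightarrow> t \<in> {0..1} \<Longrightarrow> \<bar>s - t\<bar> \<le> 1 / real n \<Longrightarrow> norm (h s - h t) \<le> e"
  shows "norm (integral {0..1} h - (\<Sum>k<n. (1 / real n) *\<^sub>R h (real k / real n))) \<le> e"
proof -
  \<comment> \<open>The induction adds one mesh interval at a time, so the bound has to be
    proportional to the length covered so far.\<close>
  have "norm (integral {0..real m / real n} h - (\<Sum>k<m. (1 / real n) *\<^sub>R h (real k / real n))) \<le> e * (real m / real n)"
    if "m \<le> n" for m
    using that
  proof (induction m)
    case 0
    then show ?case by simp
  next
    case (Suc m)
    let ?a = "real m / real n" and ?b = "real (Suc m) / real n"
    have ab: "0 \<le> ?a" "?a \<le> ?b" "?b \<le> 1" "?b - ?a = 1 / real n"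
      using Suc.prems \<open>n > 0\<close> by (auto simp: field_simps)
    have ci: "continuous_on {0..?b} h" "continuous_on {?a..?b} h"
    proof -
      have "{0..?b} \<subseteq> {0..1}" "{?a..?b} \<subseteq> {0..1}"
        unfolding atLeastatMost_subset_iff using ab by blast+
      then show "continuous_on {0..?b} h" "continuous_on {?a..?b} h"
        using h by (blast intro: continuous_on_subset)+
    qed
    have "((\<lambda>t. h t - h ?a) has_integral (integral {?a..?b} h - (1 / real n) *\<^sub>R h ?a)) (cbox ?a ?b)"
      using has_integral_diff[OF integrable_integral[OF integrable_continuous_real[OF ci(2)]] has_integral_const_real[of "h ?a" ?a ?b]] ab
      by simp
    then have "norm (integral {?a..?b} h - (1 / real n) *\<^sub>R h ?a) \<le> e * measure lborel (cbox ?a ?b)"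
    proof (rule has_integral_bound[rotated])
      show "0 \<le> e"
        using close[of 0 0] by simp
      show "norm (h t - h ?a) \<le> e" if "t \<in> cbox ?a ?b" for t
      proof -
        have "?a \<le> t" "t \<le> ?b"
          using that by (auto simp only: box_real atLeastAtMost_iff)
        then have "0 \<le> t" "t \<le> 1" "?a \<le> 1" "\<bar>t - ?a\<bar> \<le> 1 / real n"
          using ab by linarith+
        then show ?thesis
          using ab(1) by (intro close) (simp_all only: atLeastAtMost_iff)
      qed
    qed
    then have 1: "norm (integral {?a..?b} h - (1 / real n) *\<^sub>R h ?a) \<le> e * (1 / real n)"
      using ab by simp
    have "integral {0..?b} h = integral {0..?a} h + integral {?a..?b} h"
      using ab integrable_continuous_real[OF ci(1)] by (simp add: Henstock_Kurzweil_Integration.integral_combine)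
    then have "norm (integral {0..?b} h - (\<Sum>k<Suc m. (1 / real n) *\<^sub>R h (real k / real n))) =
      norm ((integral {0..?a} h - (\<Sum>k<m. (1 / real n) *\<^sub>R h (real k / real n))) + (integral {?a..?b} h - (1 / real n) *\<^sub>R h ?a))"
      by (simp add: algebra_simps)
    also have "\<dots> \<le> e * ?a + e * (1 / real n)"
      using Suc 1 by (intro norm_triangle_mono) auto
    also have "\<dots> = e * ?b"
      by (simp add: add_divide_distrib distrib_left)
    finally show ?case .
  qed
  from this[of n] show ?thesis
    using \<open>n > 0\<close> by simp
qed

text \<open>The integrand is uniformly continuous in the parameter and \<open>z\<close> jointly on
  the compact set \<open>{0..1} \<times> K\<close>, so a single mesh serves all \<open>z\<close>.
  Each term of the Riemann sum is a constant times \<open>1 / (z - w)\<close> with \<open>w\<close>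
  on the segment, hence off \<open>K\<close>.\<close>

lemma unif_closure_Cauchy_integral_linepath:
  assumes K: "compact K" and f: "continuous_on (closed_segment a b) f" and disj: "closed_segment a b \<inter> K = {}"
    and R: "\<And>w. w \<notin> K \<Longrightarrow> unif_closure K R (\<lambda>z. 1 / (z - w))" "(\<lambda>z. 0) \<in> R"
      "\<And>f g. f \<in> R \<Longrightarrow> g \<in> R \<Longrightarrow> (\<lambda>z. f z + g z) \<in> R" "\<And>c f. f \<in> R \<Longrightarrow> (\<lambda>z. c * f z) \<in> R"
  shows "unif_closure K R (\<lambda>z. contour_integral (linepath a b) (\<lambda>w. f w / (w - z)))"
proof (rule unif_closureI)
  fix e :: real assume e: "e > 0"
  define h where "h = (\<lambda>z t. f (linepath a b t) / (linepath a b t - z) * (b - a))"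
  have lp: "linepath a b t \<in> closed_segment a b" if "t \<in> {0..1}" for t
    using that by (auto simp: linepath_in_path)
  have ne: "linepath a b t \<noteq> z" if "t \<in> {0..1}" "z \<in> K" for t z
    using lp[OF that(1)] that(2) disj by blast
  have cfl: "continuous_on {0..1} (\<lambda>t. f (linepath a b t))"
    by (intro continuous_on_compose2[OF f] continuous_intros) (use lp in auto)
  have "continuous_on ({0..1} \<times> K) (\<lambda>x. h (snd x) (fst x))"
    unfolding h_def
    by (intro continuous_intros continuous_on_compose2[OF cfl] continuous_on_compose2[OF continuous_on_linepath[of UNIV]])
       (auto simp: ne)
  then have "uniformly_continuous_on ({0..1} \<times> K) (\<lambda>x. h (snd x) (fst x))"
    using K by (intro compact_uniformly_continuous compact_Times) auto
  then obtain \<delta> where \<delta>: "\<delta> > 0" "\<And>x y. x \<in> {0..1} \<times> K \<Longrightarrow> y \<in> {0..1} \<times> K \<Longrightarrow> dist y x < \<delta> \<Longrightarrow>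
      dist (h (snd y) (fst y)) (h (snd x) (fst x)) < e"
    unfolding uniformly_continuous_on_def using e by metis
  obtain n where n: "n > 0" "1 / real n < \<delta>"
    using real_arch_inverse[of \<delta>] \<delta>(1) by (auto simp: inverse_eq_divide)
  define r where "r = (\<lambda>z. \<Sum>k<n. (1 / real n) *\<^sub>R h z (real k / real n))"
  have "dist (contour_integral (linepath a b) (\<lambda>w. f w / (w - z))) (r z) \<le> e" if z: "z \<in> K" for z
  proof -
    have "contour_integral (linepath a b) (\<lambda>w. f w / (w - z)) = integral {0..1} (h z)"
      by (simp add: contour_integral_integral h_def)
    moreover have "norm (integral {0..1} (h z) - r z) \<le> e"
      unfolding r_def
    proof (rule norm_integral_Riemann_sum_le)
      show "continuous_on {0..1} (h z)"
        unfolding h_def by (intro continuous_intros cfl) (use ne z in auto)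
      fix s t :: real assume "s \<in> {0..1}" "t \<in> {0..1}" "\<bar>s - t\<bar> \<le> 1 / real n"
      then show "norm (h z s - h z t) \<le> e"
        using \<delta>(2)[of "(t, z)" "(s, z)"] z n by (simp add: dist_Pair_Pair dist_norm)
    qed (use n in auto)
    ultimately show ?thesis
      by (simp add: dist_norm)
  qed
  moreover have "unif_closure K R r"
  proof -
    have "unif_closure K R (\<lambda>z. \<Sum>k<m. (1 / real n) *\<^sub>R h z (real k / real n))" if "m \<le> n" for m
      using that
    proof (induction m)
      case 0
      then show ?case
        using R(2) by (simp add: unif_closure_base)
    next
      case (Suc m)
      define w where "w = linepath a b (real m / real n)"
      have "w \<notin> K"
        using Suc.prems lp[of "real m / real n"] disj n by (auto simp: w_def)
      \<comment> \<open>The minus sign turns \<open>1 / (w - z)\<close> of the Cauchy kernel into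
        \<open>1 / (z - w)\<close>.\<close>
      then have "unif_closure K R (\<lambda>z. - (1 / real n) * f w * (b - a) * (1 / (z - w)))"
        by (intro unif_closure_scale R)
      then have "unif_closure K R (\<lambda>z. (1 / real n) *\<^sub>R h z (real m / real n))"
      proof (rule unif_closure_cong)
        fix z assume "z \<in> K"
        with \<open>w \<notin> K\<close> have "w - z \<noteq> 0" "z - w \<noteq> 0"
          by auto
        then show "- (1 / real n) * f w * (b - a) * (1 / (z - w)) = (1 / real n) *\<^sub>R h z (real m / real n)"
          unfolding h_def w_def[symmetric] scaleR_conv_of_real by (simp add: divide_simps) (simp add: algebra_simps)
      qed
      then show ?case
        using Suc by (simp add: unif_closure_add R)
    qed
    then show ?thesis
      by (simp add: r_def)
  qed
  ultimately show "\<exists>g. unif_closure K R g \<and> (\<forall>z\<in>K. dist (contour_integral (linepath a b) (\<lambda>w. f w / (w - z))) (g z) \<le> e)"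
    by blast
qed

text \<open>Expansion into the geometric series with terms \<open>v z ^ k / u z ^ Suc k\<close>.
  Taking \<open>u\<close> constant and \<open>v z = - z\<close> moves a pole to infinity; taking
  \<open>u z = z - w\<close> and \<open>v\<close> constant moves it to \<open>w\<close>.\<close>

lemma unif_closure_inverse_diff:
  fixes K :: "complex set" and u v :: "complex \<Rightarrow> complex"
  assumes R: "(\<lambda>z. 0) \<in> R" "\<And>f g. f \<in> R \<Longrightarrow> g \<in> R \<Longrightarrow> (\<lambda>z. f z + g z) \<in> R"
      "\<And>k. (\<lambda>z. v z ^ k / u z ^ Suc k) \<in> R"
    and u: "\<And>z. z \<in> K \<Longrightarrow> u z \<noteq> 0"
    and c: "c < 1" "\<And>z. z \<in> K \<Longrightarrow> norm (v z) \<le> c * norm (u z)"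
    and \<delta>: "\<delta> > 0" "\<And>z. z \<in> K \<Longrightarrow> \<delta> \<le> norm (u z)"
  shows "unif_closure K R (\<lambda>z. 1 / (u z - v z))"
proof (cases "K = {}")
  case True
  then show ?thesis
    using R(1) by (auto simp: unif_closure_def)
next
  case False
  \<comment> \<open>The sign of \<open>c\<close> is read off at a point of \<open>K\<close>, which
    is why the empty set is treated apart.\<close>
  then have "c \<ge> 0"
    using c(2) u by (metis ex_in_conv norm_ge_zero norm_le_zero_iff order_trans zero_le_mult_iff)
  show ?thesis
    unfolding unif_closure_def
  proof (intro allI impI)
    fix e :: real assume e: "e > 0"
    define r where "r = (\<lambda>n z. \<Sum>k<n. v z ^ k / u z ^ Suc k)"
    have rR: "r n \<in> R" for n
      unfolding r_def by (induction n) (auto intro!: R simp del: power_Suc)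
    \<comment> \<open>The remainder after \<open>n\<close> terms is
      \<open>(v z / u z) ^ n / (u z - v z)\<close>, of norm at most
      \<open>c ^ n / (\<delta> * (1 - c))\<close>.\<close>
    have pos: "e * (\<delta> * (1 - c)) > 0"
      using e c \<delta> by simp
    obtain n where n: "c ^ n < e * (\<delta> * (1 - c))"
      using real_arch_pow_inv[OF pos c(1)] by blast
    have "dist (1 / (u z - v z)) (r n z) \<le> e" if z: "z \<in> K" for z
    proof -
      have uz: "u z \<noteq> 0" "norm (u z) > 0"
        using u z by auto
      have x: "norm (v z / u z) \<le> c"
        using c(2)[OF z] uz by (simp add: norm_divide divide_simps)
      then have ne: "v z / u z \<noteq> 1"
        using c(1) by auto
      have "r n z = (1 / u z) * (\<Sum>k<n. (v z / u z) ^ k)"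
        unfolding r_def sum_distrib_left by (simp add: power_divide)
      also have "\<dots> = (1 / u z) * ((1 - (v z / u z) ^ n) / (1 - v z / u z))"
        unfolding sum_gp_strict using ne by (simp only: if_False)
      finally have "1 / (u z - v z) - r n z = (v z / u z) ^ n / (u z * (1 - v z / u z))"
      proof -
        assume r: "r n z = (1 / u z) * ((1 - (v z / u z) ^ n) / (1 - v z / u z))"
        have "u z - v z = u z * (1 - v z / u z)"
          using uz by (simp add: field_simps)
        then show ?thesis
          by (simp add: r diff_divide_distrib)
      qed
      also have "norm \<dots> \<le> c ^ n / (\<delta> * (1 - c))"
        unfolding norm_divide norm_power norm_mult
      proof (rule frac_le)
        show "(cmod (v z) / cmod (u z)) ^ n \<le> c ^ n"
          using x by (intro power_mono) (auto simp: norm_divide)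
        have "1 - c \<le> norm (1 - v z / u z)"
          using norm_triangle_ineq2[of 1 "v z / u z"] x by simp
        then show "\<delta> * (1 - c) \<le> cmod (u z) * cmod (1 - v z / u z)"
          using \<delta>(2)[OF z] \<delta>(1) c(1) by (intro mult_mono) auto
      qed (use \<delta> c \<open>c \<ge> 0\<close> in auto)
      also have "\<dots> \<le> e"
        using n \<delta> c by (simp add: divide_le_eq mult.commute)
      finally show ?thesis
        by (simp add: dist_norm)
    qed
    with rR show "\<exists>r\<in>R. \<forall>z\<in>K. dist (1 / (u z - v z)) (r z) \<le> e"
      by blast
  qed
qed

text \<open>
  A point off this compact set is either farther from the origin than the set itself or closer to a point
  \<open>w \<notin> \<Omega>\<close> than the set is, so that a single geometric series moves a pole to infinity or to \<open>w\<close>.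
\<close>
definition exhaust_compact :: "complex set \<Rightarrow> nat \<Rightarrow> complex set" where
  "exhaust_compact \<Omega> n = {z. norm z \<le> real n \<and> (\<forall>w\<in>-\<Omega>. 1 / real (Suc n) \<le> dist z w)}"

lemma exhaust_compact_subset: "exhaust_compact \<Omega> n \<subseteq> \<Omega>"
proof
  fix z assume z: "z \<in> exhaust_compact \<Omega> n"
  show "z \<in> \<Omega>"
  proof (rule ccontr)
    assume "z \<notin> \<Omega>"
    with z have "1 / real (Suc n) \<le> dist z z"
      unfolding exhaust_compact_def by blast
    then show False
      by simp
  qed
qed

lemma compact_exhaust_compact: "compact (exhaust_compact \<Omega> n)"
proof -
  have "exhaust_compact \<Omega> n = cball 0 (real n) \<inter> (\<Inter>w\<in>-\<Omega>. {z. 1 / real (Suc n) \<le> dist z w})"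
    by (auto simp: exhaust_compact_def)
  then show ?thesis
    by (auto intro!: compact_Int_closed closed_INT closed_Collect_le continuous_intros)
qed

lemma exhaust_compact_mono: "m \<le> n \<Longrightarrow> exhaust_compact \<Omega> m \<subseteq> exhaust_compact \<Omega> n"
proof -
  assume "m \<le> n"
  then have "1 / real (Suc n) \<le> 1 / real (Suc m)" "real m \<le> real n"
    by (simp_all add: field_simps)
  then show ?thesis
    unfolding exhaust_compact_def by force
qed

lemma compact_subset_exhaust_compact:
  assumes "open \<Omega>" "compact K" "K \<subseteq> \<Omega>"
  shows "\<exists>n. K \<subseteq> exhaust_compact \<Omega> n"
proof -
  obtain e where e: "e > 0" "(\<Union>x\<in>K. cball x e) \<subseteq> \<Omega>"
    using compact_subset_open_imp_cball_epsilon_subset[OF assms(2,1,3)] by blast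
  obtain B where B: "\<And>z. z \<in> K \<Longrightarrow> norm z \<le> B"
    using compact_imp_bounded[OF assms(2)] by (auto simp: bounded_iff)
  obtain n1 where n1: "B \<le> real n1"
    using real_arch_simple by blast
  obtain n2 where n2: "n2 > 0" "1 / real n2 < e"
    using real_arch_inverse[of e] e(1) by (auto simp: inverse_eq_divide)
  define n where "n = max n1 n2"
  have "1 / real (Suc n) \<le> 1 / real n2"
    using n2(1) by (intro frac_le) (auto simp: n_def)
  then have n: "B \<le> real n" "1 / real (Suc n) < e"
    using n1 n2 by (auto simp: n_def)
  have "1 / real (Suc n) \<le> dist z w" if "z \<in> K" "w \<notin> \<Omega>" for z w
    using e(2) that n(2) by force
  with B n(1) have "K \<subseteq> exhaust_compact \<Omega> n"
    by (force simp: exhaust_compact_def)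
  then show ?thesis ..
qed

section \<open>Rational functions with poles off \<Omega>, and Runge's theorem\<close>

text \<open>The fraction need not be reduced and the values off \<Omega> are left free, so sums and
  products remain in the set by the naive formulas. Reduction is postponed to
  \<open>rational_on_coprime\<close>.\<close>

definition rational_on :: "complex set \<Rightarrow> (complex \<Rightarrow> complex) set" where
  "rational_on \<Omega> = {r. \<exists>P Q. (\<forall>z\<in>\<Omega>. poly Q z \<noteq> 0) \<and> (\<forall>z\<in>\<Omega>. r z = poly P z / poly Q z)}"

lemma rational_onI:
  "(\<And>z. z \<in> \<Omega> \<Longrightarrow> poly Q z \<noteq> 0) \<Longrightarrow> (\<And>z. z \<in> \<Omega> \<Longrightarrow> r z = poly P z / poly Q z) \<Longrightarrow> r \<in> rational_on \<Omega>"
  unfolding rational_on_def by blast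

lemma rational_on_const: "(\<lambda>z. c) \<in> rational_on \<Omega>"
  by (rule rational_onI[of _ 1 _ "[:c:]"]) auto

lemma rational_on_add:
  assumes "f \<in> rational_on \<Omega>" "g \<in> rational_on \<Omega>"
  shows "(\<lambda>z. f z + g z) \<in> rational_on \<Omega>"
proof -
  obtain P Q P' Q' where *: "\<And>z. z \<in> \<Omega> \<Longrightarrow> poly Q z \<noteq> 0" "\<And>z. z \<in> \<Omega> \<Longrightarrow> f z = poly P z / poly Q z"
      "\<And>z. z \<in> \<Omega> \<Longrightarrow> poly Q' z \<noteq> 0" "\<And>z. z \<in> \<Omega> \<Longrightarrow> g z = poly P' z / poly Q' z"
    using assms unfolding rational_on_def by blast
  show ?thesis
    by (rule rational_onI[of _ "Q * Q'" _ "P * Q' + P' * Q"]) (auto simp: * add_frac_eq)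
qed

lemma rational_on_mult:
  assumes "f \<in> rational_on \<Omega>" "g \<in> rational_on \<Omega>"
  shows "(\<lambda>z. f z * g z) \<in> rational_on \<Omega>"
proof -
  obtain P Q P' Q' where *: "\<And>z. z \<in> \<Omega> \<Longrightarrow> poly Q z \<noteq> 0" "\<And>z. z \<in> \<Omega> \<Longrightarrow> f z = poly P z / poly Q z"
      "\<And>z. z \<in> \<Omega> \<Longrightarrow> poly Q' z \<noteq> 0" "\<And>z. z \<in> \<Omega> \<Longrightarrow> g z = poly P' z / poly Q' z"
    using assms unfolding rational_on_def by blast
  show ?thesis
    by (rule rational_onI[of _ "Q * Q'" _ "P * P'"]) (auto simp: *)
qed

lemma rational_on_scale: "f \<in> rational_on \<Omega> \<Longrightarrow> (\<lambda>z. c * f z) \<in> rational_on \<Omega>"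
  by (rule rational_on_mult[OF rational_on_const])

lemma unif_closure_rational_on_inverse:
  assumes b: "b \<notin> exhaust_compact \<Omega> n"
  shows "unif_closure (exhaust_compact \<Omega> n) (rational_on \<Omega>) (\<lambda>z. 1 / (z - b))"
proof (cases "norm b > real n")
  case True
  \<comment> \<open>The pole lies outside the disc of radius \<open>n\<close>, so the expansion is
    in powers of \<open>z / b\<close> and the partial sums are polynomials.\<close>
  have "unif_closure (exhaust_compact \<Omega> n) (rational_on \<Omega>) (\<lambda>z. 1 / ((- b) - (- z)))"
  proof (rule unif_closure_inverse_diff[where c = "real n / norm b" and \<delta> = "norm b"])
    show "(\<lambda>z. (- z) ^ k / (- b) ^ Suc k) \<in> rational_on \<Omega>" for k
      using True by (intro rational_onI[where Q = "[:(-b) ^ Suc k:]" and P = "[:0, -1:] ^ k"]) auto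
    show "real n / norm b < 1"
      using True le_less_trans[OF of_nat_0_le_iff True] by (simp only: pos_divide_less_eq mult_1)
  qed (use True in \<open>auto simp: exhaust_compact_def rational_on_const rational_on_add\<close>)
  then show ?thesis
    by simp
next
  case False
  \<comment> \<open>The point \<open>w\<close> is strictly nearer to \<open>b\<close> than to any
    point of the compact set; the strictness gives a ratio below 1.\<close>
  with b obtain w where w: "w \<notin> \<Omega>" "dist b w < 1 / real (Suc n)"
    by (auto simp: exhaust_compact_def not_le)
  have far: "1 / real (Suc n) \<le> norm (z - w)" if "z \<in> exhaust_compact \<Omega> n" for z
    using that w(1) by (auto simp: exhaust_compact_def dist_norm)
  have "unif_closure (exhaust_compact \<Omega> n) (rational_on \<Omega>) (\<lambda>z. 1 / ((z - w) - (b - w)))"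
  proof (rule unif_closure_inverse_diff[where c = "dist b w * real (Suc n)" and \<delta> = "1 / real (Suc n)"])
    show "(\<lambda>z. (b - w) ^ k / (z - w) ^ Suc k) \<in> rational_on \<Omega>" for k
      using w(1) by (intro rational_onI[where Q = "[:-w, 1:] ^ Suc k" and P = "[:(b - w) ^ k:]"])
        (auto simp del: power_Suc)
    show "dist b w * real (Suc n) < 1"
      using w(2) by (simp add: pos_less_divide_eq del: of_nat_Suc)
    show "norm (b - w) \<le> dist b w * real (Suc n) * norm (z - w)" if "z \<in> exhaust_compact \<Omega> n" for z
    proof -
      have "dist b w * 1 \<le> dist b w * (real (Suc n) * norm (z - w))"
        using far[OF that] by (intro mult_left_mono) (simp_all add: divide_le_eq mult.commute del: of_nat_Suc)
      then show ?thesis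
        by (simp add: dist_norm mult.assoc)
    qed
    show "z - w \<noteq> 0" if "z \<in> exhaust_compact \<Omega> n" for z
      using that w(1) exhaust_compact_subset by auto
  qed (use far in \<open>auto simp: rational_on_const rational_on_add\<close>)
  then show ?thesis
    by simp
qed

text \<open>\<open>grid_decomposition_induct\<close> with uniform approximability as its predicate:
  the Cauchy integrals run over segments off the compact set, and the poles of their Riemann sums
  can be pushed out of \<Omega>.\<close>

theorem Runge_exhaust_compact:
  assumes "open \<Omega>" "f holomorphic_on \<Omega>"
  shows "unif_closure (exhaust_compact \<Omega> n) (rational_on \<Omega>) f"
proof (rule grid_decomposition_induct[OF assms(1) compact_exhaust_compact exhaust_compact_subset assms(2)])
  fix a b assume ab: "closed_segment a b \<subseteq> \<Omega> - exhaust_compact \<Omega> n"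
  show "unif_closure (exhaust_compact \<Omega> n) (rational_on \<Omega>) (\<lambda>z. contour_integral (linepath a b) (\<lambda>w. f w / (w - z)))"
  proof (rule unif_closure_Cauchy_integral_linepath)
    show "continuous_on (closed_segment a b) f"
      using ab by (intro continuous_on_subset[OF holomorphic_on_imp_continuous_on[OF assms(2)]]) auto
  qed (use ab in \<open>auto intro: compact_exhaust_compact unif_closure_rational_on_inverse rational_on_const
        rational_on_add rational_on_scale\<close>)
qed (auto intro: unif_closure_base unif_closure_add unif_closure_scale unif_closure_cong
      rational_on_const rational_on_add rational_on_scale)

section \<open>The linear Pade problem\<close>

text \<open>
  Cramer's rule for the denominator, multiplied through by the Hankel determinant: the coefficients are
  polynomials in the Taylor coefficients, at the price of the normalisation \<open>Q(0) = 1\<close>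
  becoming \<open>Q(0) = det\<close>.
\<close>
definition den_coeff :: "complex fps \<Rightarrow> nat \<Rightarrow> nat \<Rightarrow> nat \<Rightarrow> complex" where
  "den_coeff a p q k =
    (if k = 0 then Determinant.det (hankel_mat a p q)
     else if k \<le> q then - (\<Sum>i<q. adj_mat (hankel_mat a p q) $$ (q - k, i) * fps_nth a (p + 1 + i))
     else 0)"

definition num_coeff :: "complex fps \<Rightarrow> nat \<Rightarrow> nat \<Rightarrow> nat \<Rightarrow> complex" where
  "num_coeff a p q v = (if v \<le> p then \<Sum>k\<le>v. den_coeff a p q k * fps_nth a (v - k) else 0)"

definition pade_den :: "complex fps \<Rightarrow> nat \<Rightarrow> nat \<Rightarrow> complex poly" where
  "pade_den a p q = (\<Sum>k\<le>q. Polynomial.monom (den_coeff a p q k) k)"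

definition pade_num :: "complex fps \<Rightarrow> nat \<Rightarrow> nat \<Rightarrow> complex poly" where
  "pade_num a p q = (\<Sum>v\<le>p. Polynomial.monom (num_coeff a p q v) v)"

text \<open>The Pade conditions cleared of denominators, with remainder of order above
  \<open>p + q\<close>. Without the normalisation \<open>Q(0) = 1\<close> the solutions form a
  linear space, so nonuniqueness can be exhibited by solutions with \<open>Q(0) = 0\<close>.\<close>

definition lin_pade :: "complex fps \<Rightarrow> nat \<Rightarrow> nat \<Rightarrow> complex poly \<Rightarrow> complex poly \<Rightarrow> bool" where
  "lin_pade a p q P Q \<longleftrightarrow> Polynomial.degree P \<le> p \<and> Polynomial.degree Q \<le> q \<and>
     (\<forall>v\<le>p + q. fps_nth (fps_of_poly Q * a) v = Polynomial.coeff P v)"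

lemma coeff_pade_den: "Polynomial.coeff (pade_den a p q) k = den_coeff a p q k"
  by (auto simp: pade_den_def Polynomial.coeff_sum sum.delta den_coeff_def)

lemma coeff_pade_num: "Polynomial.coeff (pade_num a p q) k = num_coeff a p q k"
  by (auto simp: pade_num_def Polynomial.coeff_sum sum.delta num_coeff_def)

lemma degree_pade_den: "Polynomial.degree (pade_den a p q) \<le> q"
  by (rule Polynomial.degree_le) (auto simp: coeff_pade_den den_coeff_def)

lemma degree_pade_num: "Polynomial.degree (pade_num a p q) \<le> p"
  by (rule Polynomial.degree_le) (auto simp: coeff_pade_num num_coeff_def)

lemma hankel_mat_carrier [simp]: "hankel_mat a p q \<in> carrier_mat q q"
  by (simp add: hankel_mat_def)

lemma fps_nth_int_diff:
  "fps_nth_int a (int n - int k) = (if k \<le> n then fps_nth a (n - k) else 0)"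
  by (auto simp: fps_nth_int_def nat_diff_distrib)

text \<open>The linearised equations beyond degree \<open>p\<close> are a linear system with the
  Hankel matrix. The unknowns enter in reverse order: column \<open>j\<close> belongs to coefficient
  \<open>q - j\<close>, which explains the row index \<open>q - k\<close> in
  \<open>den_coeff\<close>.\<close>

lemma fps_nth_poly_mult_hankel:
  assumes Q: "Polynomial.degree Q \<le> q" and i: "i < q"
  shows "fps_nth (fps_of_poly Q * a) (p + 1 + i) = Polynomial.coeff Q 0 * fps_nth a (p + 1 + i) +
     (\<Sum>j<q. hankel_mat a p q $$ (i, j) * Polynomial.coeff Q (q - j))"
proof -
  let ?n = "p + 1 + i"
  let ?g = "\<lambda>k. Polynomial.coeff Q k * fps_nth_int a (int ?n - int k)"
  have "fps_nth (fps_of_poly Q * a) ?n = (\<Sum>k\<in>{0..?n}. ?g k)"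
    unfolding fps_mult_nth fps_nth_int_diff by (intro sum.cong) auto
  \<comment> \<open>Either of \<open>?n\<close> and \<open>q\<close> may be the larger one. Added
    terms vanish by the convention for negative indices, dropped ones by the degree of
    \<open>Q\<close>.\<close>
  also have "\<dots> = (\<Sum>k\<in>{0..max ?n q}. ?g k)"
    unfolding fps_nth_int_diff by (rule sum.mono_neutral_left) auto
  also have "\<dots> = (\<Sum>k\<in>{..q}. ?g k)"
    using Q by (intro sum.mono_neutral_right) (auto intro: Polynomial.coeff_eq_0)
  also have "\<dots> = ?g 0 + (\<Sum>k<q. ?g (Suc k))"
    by (simp add: sum.atMost_shift)
  also have "(\<Sum>k<q. ?g (Suc k)) = (\<Sum>k<q. ?g (Suc (q - Suc k)))"
    by (rule sum.nat_diff_reindex[symmetric])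
  also have "\<dots> = (\<Sum>j<q. hankel_mat a p q $$ (i, j) * Polynomial.coeff Q (q - j))"
  proof (rule sum.cong[OF refl])
    fix j assume "j \<in> {..<q}"
    then have j: "j < q" by simp
    then have "Suc (q - Suc j) = q - j"
      by simp
    moreover have "int ?n - int (q - j) = int p - int q + int i + int j + 1"
      using j by simp
    ultimately have "?g (Suc (q - Suc j)) = Polynomial.coeff Q (q - j) * fps_nth_int a (int p - int q + int i + int j + 1)"
      by (simp only:)
    then show "?g (Suc (q - Suc j)) = hankel_mat a p q $$ (i, j) * Polynomial.coeff Q (q - j)"
      using i j by (simp add: hankel_mat_def)
  qed
  also have "?g 0 = Polynomial.coeff Q 0 * fps_nth a ?n"
    unfolding fps_nth_int_diff by simp
  finally show ?thesis .
qed

lemma adj_mat_index: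
  fixes A :: "'a::comm_ring_1 Matrix.mat"
  assumes A: "A \<in> carrier_mat n n" and ij: "i < n" "j < n"
  shows "(\<Sum>k<n. A $$ (i, k) * adj_mat A $$ (k, j)) = (if i = j then Determinant.det A else 0)"
    and "(\<Sum>k<n. adj_mat A $$ (i, k) * A $$ (k, j)) = (if i = j then Determinant.det A else 0)"
proof -
  note adj = adj_mat[OF A]
  have prod: "(B * C) $$ (i, j) = (\<Sum>k<n. B $$ (i, k) * C $$ (k, j))"
    if "B \<in> carrier_mat n n" "C \<in> carrier_mat n n" for B C :: "'a Matrix.mat"
    using that ij by (simp add: Matrix.scalar_prod_def atLeast0LessThan)
  show "(\<Sum>k<n. A $$ (i, k) * adj_mat A $$ (k, j)) = (if i = j then Determinant.det A else 0)"
    unfolding prod[OF A adj(1), symmetric] adj(2) using ij by simp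
  show "(\<Sum>k<n. adj_mat A $$ (i, k) * A $$ (k, j)) = (if i = j then Determinant.det A else 0)"
    unfolding prod[OF adj(1) A, symmetric] adj(3) using ij by simp
qed

text \<open>Up to degree \<open>p\<close> the numerator is the truncated product. Beyond it, the
  product of the Hankel matrix with its adjugate is the determinant times the identity, which solves
  the system even for a singular matrix.\<close>

lemma lin_pade_pade: "lin_pade a p q (pade_num a p q) (pade_den a p q)"
  unfolding lin_pade_def
proof (intro conjI allI impI degree_pade_num degree_pade_den)
  fix v assume v: "v \<le> p + q"
  let ?H = "hankel_mat a p q"
  show "fps_nth (fps_of_poly (pade_den a p q) * a) v = Polynomial.coeff (pade_num a p q) v"
  proof (cases "v \<le> p")
    case True
    then show ?thesis
      by (simp add: fps_mult_nth coeff_pade_den coeff_pade_num num_coeff_def atLeast0AtMost)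
  next
    case False
    define i where "i = v - (p + 1)"
    have i: "v = p + 1 + i" "i < q"
      using False v by (auto simp: i_def)
    have "(\<Sum>j<q. ?H $$ (i, j) * Polynomial.coeff (pade_den a p q) (q - j)) =
        (\<Sum>j<q. \<Sum>l<q. - (?H $$ (i, j) * adj_mat ?H $$ (j, l) * fps_nth a (p + 1 + l)))"
      by (intro sum.cong refl) (auto simp: coeff_pade_den den_coeff_def sum_distrib_left sum_negf mult.assoc)
    also have "\<dots> = (\<Sum>l<q. \<Sum>j<q. - (?H $$ (i, j) * adj_mat ?H $$ (j, l) * fps_nth a (p + 1 + l)))"
      by (rule sum.swap)
    also have "\<dots> = (\<Sum>l<q. - ((\<Sum>j<q. ?H $$ (i, j) * adj_mat ?H $$ (j, l)) * fps_nth a (p + 1 + l)))"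
      by (simp add: sum_negf sum_distrib_right)
    also have "\<dots> = (\<Sum>l<q. if i = l then - (Determinant.det ?H * fps_nth a (p + 1 + l)) else 0)"
      using i(2) by (intro sum.cong refl) (auto simp: adj_mat_index(1)[OF hankel_mat_carrier])
    also have "\<dots> = - (Determinant.det ?H * fps_nth a (p + 1 + i))"
      using i(2) by simp
    finally show ?thesis
      unfolding i(1) fps_nth_poly_mult_hankel[OF degree_pade_den i(2)]
      by (simp add: coeff_pade_num num_coeff_def coeff_pade_den den_coeff_def)
  qed
qed

text \<open>Multiplying the Hankel system by the adjugate from the left expresses \<open>det\<close>
  times each coefficient of \<open>Q\<close> through \<open>Q(0)\<close>. If \<open>det\<close> is
  nonzero and \<open>Q(0) = 0\<close>, this forces \<open>Q = 0\<close>.\<close>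

lemma lin_pade_unique:
  assumes "lin_pade a p q P Q"
  shows "Polynomial.smult (Determinant.det (hankel_mat a p q)) Q = Polynomial.smult (Polynomial.coeff Q 0) (pade_den a p q)"
    and "Polynomial.smult (Determinant.det (hankel_mat a p q)) P = Polynomial.smult (Polynomial.coeff Q 0) (pade_num a p q)"
proof -
  let ?H = "hankel_mat a p q"
  have deg: "Polynomial.degree P \<le> p" "Polynomial.degree Q \<le> q"
    and eq: "\<And>v. v \<le> p + q \<Longrightarrow> fps_nth (fps_of_poly Q * a) v = Polynomial.coeff P v"
    using assms by (auto simp: lin_pade_def)
  have Q: "Determinant.det ?H * Polynomial.coeff Q k = Polynomial.coeff Q 0 * den_coeff a p q k" for k
  proof (cases "k = 0 \<or> k > q")
    case True
    then show ?thesis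
      using deg(2) by (auto simp: den_coeff_def Polynomial.coeff_eq_0)
  next
    case False
    define j where "j = q - k"
    have j: "j < q" "k = q - j"
      using False by (auto simp: j_def)
    have row: "(\<Sum>l<q. ?H $$ (i, l) * Polynomial.coeff Q (q - l)) = - Polynomial.coeff Q 0 * fps_nth a (p + 1 + i)"
      if "i < q" for i
    proof -
      have "fps_nth (fps_of_poly Q * a) (p + 1 + i) = 0"
        using eq[of "p + 1 + i"] that deg(1) by (simp add: Polynomial.coeff_eq_0)
      then show ?thesis
        using fps_nth_poly_mult_hankel[OF deg(2) that, of a p] by (simp add: eq_neg_iff_add_eq_0 add.commute)
    qed
    have "Determinant.det ?H * Polynomial.coeff Q k = (\<Sum>l<q. if j = l then Determinant.det ?H * Polynomial.coeff Q (q - l) else 0)"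
      using j by simp
    also have "\<dots> = (\<Sum>l<q. (\<Sum>i<q. adj_mat ?H $$ (j, i) * ?H $$ (i, l)) * Polynomial.coeff Q (q - l))"
      using j by (intro sum.cong refl) (auto simp: adj_mat_index(2)[OF hankel_mat_carrier])
    also have "\<dots> = (\<Sum>l<q. \<Sum>i<q. adj_mat ?H $$ (j, i) * (?H $$ (i, l) * Polynomial.coeff Q (q - l)))"
      by (simp add: sum_distrib_right mult.assoc)
    also have "\<dots> = (\<Sum>i<q. \<Sum>l<q. adj_mat ?H $$ (j, i) * (?H $$ (i, l) * Polynomial.coeff Q (q - l)))"
      by (rule sum.swap)
    also have "\<dots> = (\<Sum>i<q. adj_mat ?H $$ (j, i) * (- Polynomial.coeff Q 0 * fps_nth a (p + 1 + i)))"
      by (intro sum.cong refl) (simp only: sum_distrib_left[symmetric] row lessThan_iff)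
    also have "\<dots> = Polynomial.coeff Q 0 * den_coeff a p q k"
      using j False by (simp add: den_coeff_def sum_distrib_left sum_negf mult_ac)
    finally show ?thesis .
  qed
  then show "Polynomial.smult (Determinant.det ?H) Q = Polynomial.smult (Polynomial.coeff Q 0) (pade_den a p q)"
    by (intro poly_eqI) (simp add: coeff_pade_den)
  have "Determinant.det ?H * Polynomial.coeff P v = Polynomial.coeff Q 0 * num_coeff a p q v" for v
  proof (cases "v \<le> p")
    case True
    then have "Polynomial.coeff P v = (\<Sum>k\<le>v. Polynomial.coeff Q k * fps_nth a (v - k))"
      using eq[of v] by (simp add: fps_mult_nth atLeast0AtMost)
    then have "Determinant.det ?H * Polynomial.coeff P v = (\<Sum>k\<le>v. (Determinant.det ?H * Polynomial.coeff Q k) * fps_nth a (v - k))"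
      by (simp add: sum_distrib_left mult.assoc)
    then show ?thesis
      using True by (simp add: Q num_coeff_def sum_distrib_left mult.assoc)
  next
    case False
    then show ?thesis
      using deg(1) by (simp add: num_coeff_def Polynomial.coeff_eq_0)
  qed
  then show "Polynomial.smult (Determinant.det ?H) P = Polynomial.smult (Polynomial.coeff Q 0) (pade_num a p q)"
    by (intro poly_eqI) (simp add: coeff_pade_num)
qed

lemma fps_nth_mult_low_zero:
  fixes D G :: "'a::comm_ring_1 fps"
  assumes "\<And>v. v \<le> n \<Longrightarrow> fps_nth D v = 0" "v \<le> n"
  shows "fps_nth (G * D) v = 0"
  unfolding fps_mult_nth using assms by (intro sum.neutral) auto

text \<open>
  Replacing a common factor \<open>X - c\<close> by \<open>X\<close> would give a solution of the linearised problem
  with \<open>Q(0) = 0\<close>, against uniqueness.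
\<close>
lemma pade_no_common_root:
  assumes reg: "pade_regular a p q" and c: "poly (pade_den a p q) c = 0"
  shows "poly (pade_num a p q) c \<noteq> 0"
proof
  assume c': "poly (pade_num a p q) c = 0"
  have det: "Determinant.det (hankel_mat a p q) \<noteq> 0"
    using reg by (simp add: pade_regular_def)
  then have den0: "Polynomial.coeff (pade_den a p q) 0 \<noteq> 0"
    by (simp add: coeff_pade_den den_coeff_def)
  then have "c \<noteq> 0"
    using c by (auto simp: poly_0_coeff_0)
  obtain D where D: "pade_den a p q = [:-c, 1:] * D"
    using c by (metis poly_eq_0_iff_dvd dvdE)
  obtain N where N: "pade_num a p q = [:-c, 1:] * N"
    using c' by (metis poly_eq_0_iff_dvd dvdE)
  have "D \<noteq> 0"
    using D den0 by auto
  have low: "fps_nth (fps_of_poly D * a - fps_of_poly N) v = 0" if v: "v \<le> p + q" for v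
  proof -
    let ?X = "fps_of_poly [:-c, 1:]"
    have X: "fps_nth ?X 0 \<noteq> 0"
      using \<open>c \<noteq> 0\<close> by simp
    \<comment> \<open>As \<open>c\<close> is nonzero, \<open>X - c\<close> is a unit among power
      series, and removing it does not change the order of vanishing.\<close>
    have "fps_of_poly D * a - fps_of_poly N = inverse ?X * (?X * (fps_of_poly D * a - fps_of_poly N))"
      using inverse_mult_eq_1[OF X] by (metis mult.assoc mult_1)
    also have "?X * (fps_of_poly D * a - fps_of_poly N) = fps_of_poly (pade_den a p q) * a - fps_of_poly (pade_num a p q)"
      unfolding D N fps_of_poly_mult by (simp only: right_diff_distrib mult.assoc)
    also have "fps_nth (inverse ?X * (fps_of_poly (pade_den a p q) * a - fps_of_poly (pade_num a p q))) v = 0"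
      using lin_pade_pade[of a p q] v by (intro fps_nth_mult_low_zero[of "p + q"]) (auto simp: lin_pade_def)
    finally show ?thesis .
  qed
  \<comment> \<open>Removing the factor frees one degree, which \<open>pCons 0\<close>
    (multiplication by X) uses up again.\<close>
  have degD: "Suc (Polynomial.degree D) \<le> q"
    using degree_pade_den[of a p q] \<open>D \<noteq> 0\<close> unfolding D by (subst (asm) Polynomial.degree_mult_eq) auto
  have degN: "Polynomial.degree (pCons 0 N) \<le> p"
  proof (cases "N = 0")
    case False
    then show ?thesis
      using degree_pade_num[of a p q] unfolding N by (subst (asm) Polynomial.degree_mult_eq) auto
  qed simp
  have shift: "fps_of_poly (pCons 0 D) * a = fps_X * (fps_of_poly D * a)"
    by (simp add: fps_of_poly_pCons mult_ac)
  have "lin_pade a p q (pCons 0 N) (pCons 0 D)"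
    unfolding lin_pade_def
  proof (intro conjI allI impI)
    fix v assume "v \<le> p + q"
    then show "fps_nth (fps_of_poly (pCons 0 D) * a) v = Polynomial.coeff (pCons 0 N) v"
      using low[of "v - 1"] unfolding shift by (cases v) auto
  qed (use degN degD \<open>D \<noteq> 0\<close> in auto)
  then have "Polynomial.smult (Determinant.det (hankel_mat a p q)) (pCons 0 D) = 0"
    using lin_pade_unique(1) by fastforce
  then show False
    using det \<open>D \<noteq> 0\<close> by simp
qed

section \<open>Rational functions, their expansions and their poles\<close>

text \<open>Uniqueness of Taylor expansions turns an identity of germs into one of formal series. It
  serves the approximants themselves as well as a rational \<open>f\<close> expanded about an
  arbitrary centre.\<close>

lemma fps_of_poly_mult_fps_expansion:
  assumes g: "g analytic_on {\<zeta>}" and ev: "\<forall>\<^sub>F z in nhds \<zeta>. poly Q (z - \<zeta>) * g z = poly P (z - \<zeta>)"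
  shows "fps_of_poly Q * fps_expansion g \<zeta> = fps_of_poly P"
proof (rule fps_expansion_unique_complex)
  have poly: "poly p has_fps_expansion fps_of_poly p" for p :: "complex poly"
    by (simp add: has_fps_expansion_def)
  show "(\<lambda>x. poly Q x * g (\<zeta> + x)) has_fps_expansion fps_of_poly Q * fps_expansion g \<zeta>"
    by (intro has_fps_expansion_mult poly analytic_at_imp_has_fps_expansion g)
  have "\<forall>\<^sub>F x in nhds 0. poly Q x * g (\<zeta> + x) = poly P x"
    using ev by (subst (asm) nhds_to_0) (simp add: eventually_filtermap add.commute)
  then show "(\<lambda>x. poly Q x * g (\<zeta> + x)) has_fps_expansion fps_of_poly P"
    using poly[of P] by (subst has_fps_expansion_cong) (auto elim: eventually_mono)
qed

lemma holomorphic_on_poly: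
  assumes "f holomorphic_on S"
  shows "(\<lambda>z. poly P (f z)) holomorphic_on S"
  unfolding poly_altdef using assms by (intro holomorphic_intros)

lemma open_poly_nonzero: "open {z :: complex. poly Q (z - \<zeta>) \<noteq> 0}"
  by (intro open_Collect_neq continuous_intros)

lemma analytic_rational_fun:
  assumes "poly Q (z - \<zeta>) \<noteq> 0"
  shows "(\<lambda>z. poly P (z - \<zeta>) / poly Q (z - \<zeta>)) analytic_on {z}"
proof -
  have "(\<lambda>z. poly P (z - \<zeta>) / poly Q (z - \<zeta>)) holomorphic_on {z. poly Q (z - \<zeta>) \<noteq> 0}"
    by (intro holomorphic_intros holomorphic_on_poly) auto
  then have "(\<lambda>z. poly P (z - \<zeta>) / poly Q (z - \<zeta>)) analytic_on {z. poly Q (z - \<zeta>) \<noteq> 0}"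
    using analytic_on_open[OF open_poly_nonzero] by blast
  then show ?thesis
    by (rule analytic_on_subset) (use assms in simp)
qed

lemma rational_at_eq:
  assumes "poly Q (z - \<zeta>) \<noteq> 0"
  shows "rational_at \<zeta> P Q z = poly P (z - \<zeta>) / poly Q (z - \<zeta>)"
  unfolding rational_at_def by (rule remove_sings_at_analytic[OF analytic_rational_fun[OF assms]])

lemma analytic_rational_at:
  assumes "poly Q (z - \<zeta>) \<noteq> 0"
  shows "rational_at \<zeta> P Q analytic_on {z}"
  unfolding rational_at_def
  using analytic_rational_fun[OF assms, of P]
  by (intro remove_sings_analytic_at[OF isolated_singularity_at_analytic isContD] analytic_at_imp_isCont)

lemma fps_expansion_rational_at:
  assumes "Polynomial.coeff Q 0 \<noteq> 0"
  shows "fps_of_poly Q * fps_expansion (rational_at \<zeta> P Q) \<zeta> = fps_of_poly P"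
proof (rule fps_of_poly_mult_fps_expansion)
  have *: "poly Q (\<zeta> - \<zeta>) \<noteq> 0"
    using assms by (simp add: poly_0_coeff_0)
  show "rational_at \<zeta> P Q analytic_on {\<zeta>}"
    by (rule analytic_rational_at[OF *])
  have "\<forall>\<^sub>F z in nhds \<zeta>. z \<in> {z. poly Q (z - \<zeta>) \<noteq> 0}"
    using * by (intro eventually_nhds_in_open open_poly_nonzero) simp
  then show "\<forall>\<^sub>F z in nhds \<zeta>. poly Q (z - \<zeta>) * rational_at \<zeta> P Q z = poly P (z - \<zeta>)"
    by eventually_elim (simp add: rational_at_eq)
qed

text \<open>\<open>Q(0) = 1\<close> makes \<open>Q\<close> a unit among power series. With
  \<open>E\<close> the expansion of \<open>P / Q\<close>, the series \<open>a - E\<close> and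
  \<open>Q * a - P = Q * (a - E)\<close> therefore vanish to the same order.\<close>

lemma is_pade_iff:
  "is_pade a \<zeta> p q R \<longleftrightarrow> (\<exists>P Q. lin_pade a p q P Q \<and> Polynomial.coeff Q 0 = 1 \<and> R = rational_at \<zeta> P Q)"
proof -
  have "(\<forall>v\<le>p + q. fps_nth (fps_expansion (rational_at \<zeta> P Q) \<zeta>) v = fps_nth a v) \<longleftrightarrow>
        (\<forall>v\<le>p + q. fps_nth (fps_of_poly Q * a) v = Polynomial.coeff P v)"
    if Q: "Polynomial.coeff Q 0 = 1" for P Q
  proof -
    let ?E = "fps_expansion (rational_at \<zeta> P Q) \<zeta>" and ?Q = "fps_of_poly Q" and ?P = "fps_of_poly P"
    have E: "?Q * ?E = ?P"
      using Q by (intro fps_expansion_rational_at) simp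
    have 1: "?Q * a - ?P = ?Q * (a - ?E)"
      by (simp add: E algebra_simps)
    have 2: "a - ?E = inverse ?Q * (?Q * a - ?P)"
      using inverse_mult_eq_1[of ?Q] Q unfolding 1 by (simp flip: mult.assoc)
    have "fps_nth (?Q * a - ?P) v = 0" if "\<forall>v\<le>p + q. fps_nth (a - ?E) v = 0" "v \<le> p + q" for v
      unfolding 1 by (rule fps_nth_mult_low_zero[of "p + q"]) (use that in blast)+
    moreover have "fps_nth (a - ?E) v = 0" if "\<forall>v\<le>p + q. fps_nth (?Q * a - ?P) v = 0" "v \<le> p + q" for v
      by (subst 2, rule fps_nth_mult_low_zero[of "p + q"]) (use that in blast)+
    ultimately have "(\<forall>v\<le>p + q. fps_nth (a - ?E) v = 0) \<longleftrightarrow> (\<forall>v\<le>p + q. fps_nth (?Q * a - ?P) v = 0)"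
      by blast
    moreover have "fps_nth (a - ?E) v = 0 \<longleftrightarrow> fps_nth ?E v = fps_nth a v" for v
      unfolding fps_sub_nth right_minus_eq by (rule eq_commute)
    ultimately show ?thesis
      unfolding fps_sub_nth fps_of_poly_nth right_minus_eq by simp
  qed
  then show ?thesis
    unfolding is_pade_def lin_pade_def by blast
qed

lemma rational_at_smult:
  assumes "c \<noteq> 0"
  shows "rational_at \<zeta> (Polynomial.smult c P) (Polynomial.smult c Q) = rational_at \<zeta> P Q"
  using assms by (simp add: rational_at_def)

text \<open>Dividing the determinant formulas by \<open>det\<close> gives a normalised solution. Any
  other normalised solution is proportional to them, and the factor cancels in the quotient.\<close>

lemma pade_eq:
  assumes "pade_regular a p q"
  shows "pade a \<zeta> p q = rational_at \<zeta> (pade_num a p q) (pade_den a p q)"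
  unfolding pade_def
proof (rule the_equality)
  let ?d = "Determinant.det (hankel_mat a p q)"
  have d: "?d \<noteq> 0"
    using assms by (simp add: pade_regular_def)
  have den0: "Polynomial.coeff (pade_den a p q) 0 = ?d"
    by (simp add: coeff_pade_den den_coeff_def)
  have "lin_pade a p q (Polynomial.smult (1 / ?d) (pade_num a p q)) (Polynomial.smult (1 / ?d) (pade_den a p q))"
    using lin_pade_pade[of a p q] by (auto simp: lin_pade_def fps_of_poly_smult mult.assoc)
  then show "is_pade a \<zeta> p q (rational_at \<zeta> (pade_num a p q) (pade_den a p q))"
    unfolding is_pade_iff using d den0 rational_at_smult[of "1 / ?d" \<zeta>]
    by (intro exI[of _ "Polynomial.smult (1 / ?d) (pade_num a p q)"] exI[of _ "Polynomial.smult (1 / ?d) (pade_den a p q)"]) auto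
  fix R assume "is_pade a \<zeta> p q R"
  then obtain P Q where PQ: "lin_pade a p q P Q" "Polynomial.coeff Q 0 = 1" "R = rational_at \<zeta> P Q"
    unfolding is_pade_iff by blast
  from lin_pade_unique[OF PQ(1)] PQ(2,3) show "R = rational_at \<zeta> (pade_num a p q) (pade_den a p q)"
    using rational_at_smult[OF d, of \<zeta> P Q] by simp
qed

text \<open>Poles are taken after cancellation in \<open>remove_sings\<close>. Since numerator and
  denominator have no common root, nothing cancels at a zero of the denominator, and the error is
  governed by two polynomials with continuously varying coefficients.\<close>

lemma approx_error_pade:
  assumes reg: "pade_regular a p q"
  shows "approx_error (pade a \<zeta> p q) f z =
    (if poly (pade_den a p q) (z - \<zeta>) = 0 then \<infinity>
     else ennreal (cmod (poly (pade_num a p q) (z - \<zeta>) / poly (pade_den a p q) (z - \<zeta>) - f z)))"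
proof (cases "poly (pade_den a p q) (z - \<zeta>) = 0")
  case True
  let ?N = "pade_num a p q" and ?D = "pade_den a p q"
  let ?f = "\<lambda>z. poly ?N (z - \<zeta>) / poly ?D (z - \<zeta>)"
  have N: "poly ?N (z - \<zeta>) \<noteq> 0"
    using pade_no_common_root[OF reg True] .
  have "?D \<noteq> 0"
    using reg coeff_pade_den[of a p q 0] by (auto simp: pade_regular_def den_coeff_def)
  then have fin: "finite {w. poly ?D w = 0}"
    by (rule poly_roots_finite)
  have "{w. poly ?D (w - \<zeta>) = 0} \<subseteq> (\<lambda>w. w + \<zeta>) ` {w. poly ?D w = 0}"
  proof
    fix w assume "w \<in> {w. poly ?D (w - \<zeta>) = 0}"
    then show "w \<in> (\<lambda>w. w + \<zeta>) ` {w. poly ?D w = 0}"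
      by (intro image_eqI[of _ _ "w - \<zeta>"]) auto
  qed
  then have "finite {w. poly ?D (w - \<zeta>) = 0}"
    by (rule finite_subset) (use fin in simp)
  then have ev: "\<forall>\<^sub>F w in at z. poly ?D (w - \<zeta>) \<noteq> 0"
    using islimpt_finite[of "{w. poly ?D (w - \<zeta>) = 0}" z] by (simp add: islimpt_iff_eventually)
  have "isCont (\<lambda>w. poly ?D (w - \<zeta>)) z"
    by (intro continuous_intros)
  then have "filterlim (\<lambda>w. poly ?D (w - \<zeta>)) (at 0) (at z)"
    using ev True by (auto simp: filterlim_at isCont_def)
  then have pole: "is_pole ?f z"
    using N by (intro is_pole_divide continuous_intros) auto
  \<comment> \<open>Passing to \<open>remove_sings\<close> preserves a pole at an isolated
    singularity; meromorphy of the quotient provides the isolation.\<close>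
  have "(\<lambda>w. poly R (w - \<zeta>)) analytic_on {z}" for R :: "complex poly"
    by (rule analytic_on_subset[of _ UNIV]) (auto simp: analytic_on_open intro!: holomorphic_on_poly holomorphic_intros)
  then have "?f meromorphic_on {z}"
    by (intro meromorphic_intros analytic_on_imp_meromorphic_on)
  then have "isolated_singularity_at ?f z"
    using meromorphic_on_isolated_singularity by blast
  then have "is_pole (rational_at \<zeta> ?N ?D) z"
    using pole by (simp add: rational_at_def)
  then show ?thesis
    using True by (simp add: approx_error_def pade_eq[OF reg])
next
  case False
  then have "\<not> is_pole (rational_at \<zeta> (pade_num a p q) (pade_den a p q)) z"
    using analytic_rational_at analytic_at_imp_no_pole by blast
  then show ?thesis
    using False by (simp add: approx_error_def pade_eq[OF reg] rational_at_eq)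
qed

text \<open>
  A vector in the kernel of the Hankel matrix gives \<open>D\<close> with \<open>D(0) = 0\<close> and, comparing degrees,
  \<open>A D = B N\<close>; coprimality makes \<open>D\<close> a constant multiple of \<open>B\<close>, hence zero.
\<close>
lemma pade_regular_rational:
  fixes A B :: "complex poly"
  assumes "coprime A B" "A \<noteq> 0" "Polynomial.degree A = p" "Polynomial.degree B \<le> q"
    and B0: "Polynomial.coeff B 0 \<noteq> 0" and a: "fps_of_poly B * a = fps_of_poly A"
  shows "pade_regular a p q"
  unfolding pade_regular_def
proof
  let ?H = "hankel_mat a p q"
  assume "Determinant.det ?H = 0"
  then obtain x where x: "x \<in> carrier_vec q" "x \<noteq> 0\<^sub>v q" "?H *\<^sub>v x = 0\<^sub>v q"
    using det_0_iff_vec_prod_zero[OF hankel_mat_carrier] by blast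
  \<comment> \<open>The kernel vector is read as coefficients in the reversed order of the Hankel
    system, with constant term 0 so that the right-hand side of the system vanishes.\<close>
  define D where "D = (\<Sum>k\<le>q. Polynomial.monom (if k = 0 then 0 else vec_index x (q - k)) k)"
  have coeffD: "Polynomial.coeff D k = (if k = 0 \<or> k > q then 0 else vec_index x (q - k))" for k
    by (auto simp: D_def Polynomial.coeff_sum sum.delta)
  have degD: "Polynomial.degree D \<le> q"
    by (rule Polynomial.degree_le) (auto simp: coeffD)
  define N where "N = (\<Sum>v\<le>p. Polynomial.monom (fps_nth (fps_of_poly D * a) v) v)"
  have coeffN: "Polynomial.coeff N v = (if v \<le> p then fps_nth (fps_of_poly D * a) v else 0)" for v
    by (auto simp: N_def Polynomial.coeff_sum sum.delta)
  have degN: "Polynomial.degree N \<le> p"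
    by (rule Polynomial.degree_le) (auto simp: coeffN)
  have low: "fps_nth (fps_of_poly D * a - fps_of_poly N) v = 0" if "v \<le> p + q" for v
  proof (cases "v \<le> p")
    case True
    then show ?thesis
      by (simp add: coeffN)
  next
    case False
    define i where "i = v - (p + 1)"
    have i: "v = p + 1 + i" "i < q"
      using False that by (auto simp: i_def)
    have "(\<Sum>j<q. ?H $$ (i, j) * Polynomial.coeff D (q - j)) = (\<Sum>j<q. ?H $$ (i, j) * vec_index x j)"
      by (intro sum.cong) (auto simp: coeffD)
    also have "\<dots> = vec_index (?H *\<^sub>v x) i"
      using i(2) x(1) carrier_matD[OF hankel_mat_carrier, of a p q]
      by (auto simp: Matrix.mult_mat_vec_def Matrix.scalar_prod_def atLeast0LessThan)
    also have "\<dots> = 0"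
      using x(3) i(2) by simp
    finally have "fps_nth (fps_of_poly D * a) v = 0"
      unfolding i(1) fps_nth_poly_mult_hankel[OF degD i(2)] by (simp add: coeffD)
    then show ?thesis
      using False by (simp add: coeffN)
  qed
  \<comment> \<open>The difference vanishes to order above \<open>p + q\<close> as a series and has
    degree at most \<open>p + q\<close> as a polynomial.\<close>
  have "A * D - B * N = 0"
  proof (rule poly_eqI)
    fix v
    have "fps_of_poly (A * D - B * N) = fps_of_poly B * (fps_of_poly D * a - fps_of_poly N)"
      by (simp add: fps_of_poly_mult fps_of_poly_diff a[symmetric] algebra_simps)
    then have c: "Polynomial.coeff (A * D - B * N) v = fps_nth (fps_of_poly B * (fps_of_poly D * a - fps_of_poly N)) v"
      by (metis fps_of_poly_nth)
    show "Polynomial.coeff (A * D - B * N) v = Polynomial.coeff 0 v"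
    proof (cases "v \<le> p + q")
      case True
      then show ?thesis
        unfolding c using fps_nth_mult_low_zero[of "p + q", OF low] by simp
    next
      case False
      have "Polynomial.degree (A * D) \<le> p + q" "Polynomial.degree (B * N) \<le> p + q"
        using degree_mult_le[of A D] degree_mult_le[of B N] assms(3,4) degD degN by linarith+
      then have "Polynomial.degree (A * D - B * N) \<le> p + q"
        by (rule degree_diff_le)
      with False show ?thesis
        by (simp add: Polynomial.coeff_eq_0 del: coeff_diff)
    qed
  qed
  then have AD: "A * D = B * N"
    by simp
  then have "A dvd N"
    using assms(1) by (metis coprime_dvd_mult_right_iff dvd_triv_left)
  then obtain C where C: "N = A * C"
    by (elim dvdE)
  then have DBC: "D = B * C"
    using AD assms(2) by (metis mult.left_commute mult_cancel_left)
  have "C = 0"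
  proof (rule ccontr)
    assume "C \<noteq> 0"
    \<comment> \<open>Here the exact degree of \<open>A\<close> enters: \<open>N = A * C\<close> has
      degree at most \<open>p\<close>, which leaves only a constant \<open>C\<close>.\<close>
    then have "Polynomial.degree C = 0"
      using degN assms(2,3) unfolding C by (subst (asm) Polynomial.degree_mult_eq) auto
    moreover have "Polynomial.coeff B 0 * Polynomial.coeff C 0 = 0"
      using coeffD[of 0] unfolding DBC by (simp add: coeff_mult)
    ultimately show False
      using B0 \<open>C \<noteq> 0\<close> by (metis leading_coeff_0_iff mult_eq_0_iff)
  qed
  then have "D = 0"
    using DBC by simp
  then have "vec_index x j = 0" if "j < q" for j
  proof -
    have "\<not> (q - j = 0 \<or> q - j > q)" "q - (q - j) = j"
      using that by auto
    then show ?thesis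
      using coeffD[of "q - j"] \<open>D = 0\<close> by simp
  qed
  then have "x = 0\<^sub>v q"
    using x(1) by (intro eq_vecI) auto
  with x(2) show False
    by simp
qed

lemma lin_pade_rational:
  assumes "Polynomial.degree A \<le> p" "Polynomial.degree B \<le> q" "fps_of_poly B * a = fps_of_poly A"
  shows "lin_pade a p q A B"
  using assms by (simp add: lin_pade_def)

section \<open>Continuity and genericity\<close>

lemma tendsto_det:
  fixes M :: "'b \<Rightarrow> 'a::{real_normed_field} Matrix.mat"
  assumes "\<And>m. M m \<in> carrier_mat n n" "L \<in> carrier_mat n n"
    and "\<And>i j. i < n \<Longrightarrow> j < n \<Longrightarrow> ((\<lambda>m. M m $$ (i, j)) \<longlongrightarrow> L $$ (i, j)) G"
  shows "((\<lambda>m. Determinant.det (M m)) \<longlongrightarrow> Determinant.det L) G"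
  unfolding det_def'[OF assms(1)] det_def'[OF assms(2)]
  using permutes_in_image by (intro tendsto_intros assms(3)) fastforce+

lemma tendsto_adj_mat:
  fixes M :: "'b \<Rightarrow> 'a::{real_normed_field} Matrix.mat"
  assumes M: "\<And>m. M m \<in> carrier_mat n n" "L \<in> carrier_mat n n"
    and lim: "\<And>i j. i < n \<Longrightarrow> j < n \<Longrightarrow> ((\<lambda>m. M m $$ (i, j)) \<longlongrightarrow> L $$ (i, j)) G"
    and ij: "i < n" "j < n"
  shows "((\<lambda>m. adj_mat (M m) $$ (i, j)) \<longlongrightarrow> adj_mat L $$ (i, j)) G"
proof -
  have adj: "adj_mat A $$ (i, j) = (-1) ^ (j + i) * Determinant.det (mat_delete A j i)"
    if "A \<in> carrier_mat n n" for A :: "'a Matrix.mat"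
    using that ij by (simp add: adj_mat_def cofactor_def)
  have entry: "mat_delete A j i $$ (k, l) = A $$ (if k < j then k else Suc k, if l < i then l else Suc l)"
    if "A \<in> carrier_mat n n" "k < n - 1" "l < n - 1" for A :: "'a Matrix.mat" and k l
    using that by (simp add: mat_delete_def)
  have "((\<lambda>m. Determinant.det (mat_delete (M m) j i)) \<longlongrightarrow> Determinant.det (mat_delete L j i)) G"
  proof (rule tendsto_det[OF mat_delete_carrier[OF M(1)] mat_delete_carrier[OF M(2)]])
    fix k l assume kl: "k < n - 1" "l < n - 1"
    show "((\<lambda>m. mat_delete (M m) j i $$ (k, l)) \<longlongrightarrow> mat_delete L j i $$ (k, l)) G"
      unfolding entry[OF M(1) kl] entry[OF M(2) kl] using kl by (intro lim) auto
  qed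
  then show ?thesis
    unfolding adj[OF M(1)] adj[OF M(2)] by (intro tendsto_intros)
qed

context
  fixes a :: "'b \<Rightarrow> complex fps" and b :: "complex fps" and G :: "'b filter"
  assumes coeffs: "\<And>k. ((\<lambda>m. fps_nth (a m) k) \<longlongrightarrow> fps_nth b k) G"
begin

lemma tendsto_hankel_mat:
  assumes "i < q" "j < q"
  shows "((\<lambda>m. hankel_mat (a m) p q $$ (i, j)) \<longlongrightarrow> hankel_mat b p q $$ (i, j)) G"
  using assms by (auto simp: hankel_mat_def fps_nth_int_def intro: coeffs)

lemma tendsto_hankel_det:
  "((\<lambda>m. Determinant.det (hankel_mat (a m) p q)) \<longlongrightarrow> Determinant.det (hankel_mat b p q)) G"
  by (rule tendsto_det[OF hankel_mat_carrier hankel_mat_carrier tendsto_hankel_mat])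

lemma tendsto_den_coeff: "((\<lambda>m. den_coeff (a m) p q k) \<longlongrightarrow> den_coeff b p q k) G"
proof (cases "k = 0 \<or> k > q")
  case True
  then show ?thesis
    by (auto simp: den_coeff_def intro: tendsto_hankel_det)
next
  case False
  then have "((\<lambda>m. - (\<Sum>i<q. adj_mat (hankel_mat (a m) p q) $$ (q - k, i) * fps_nth (a m) (p + 1 + i)))
      \<longlongrightarrow> - (\<Sum>i<q. adj_mat (hankel_mat b p q) $$ (q - k, i) * fps_nth b (p + 1 + i))) G"
    by (intro tendsto_intros coeffs tendsto_adj_mat[OF hankel_mat_carrier hankel_mat_carrier tendsto_hankel_mat]) auto
  with False show ?thesis
    by (simp add: den_coeff_def)
qed

lemma tendsto_num_coeff: "((\<lambda>m. num_coeff (a m) p q k) \<longlongrightarrow> num_coeff b p q k) G"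
  unfolding num_coeff_def by (cases "k \<le> p") (auto intro!: tendsto_intros tendsto_den_coeff coeffs)

text \<open>The argument varies along with the coefficients because in the application the centre
  and the evaluation point both move.\<close>

lemma tendsto_pade_den:
  assumes "(w \<longlongrightarrow> w') G"
  shows "((\<lambda>m. poly (pade_den (a m) p q) (w m)) \<longlongrightarrow> poly (pade_den b p q) w') G"
  unfolding pade_den_def poly_sum poly_monom by (intro tendsto_intros tendsto_den_coeff assms)

lemma tendsto_pade_num:
  assumes "(w \<longlongrightarrow> w') G"
  shows "((\<lambda>m. poly (pade_num (a m) p q) (w m)) \<longlongrightarrow> poly (pade_num b p q) w') G"
  unfolding pade_num_def poly_sum poly_monom by (intro tendsto_intros tendsto_num_coeff assms)

end

text \<open>Once \<open>z n\<close> is within \<open>r\<close> of the limit, the disc of radius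
  \<open>r\<close> about it lies in the larger disc of uniform convergence, and Cauchy's estimate
  bounds the derivatives of \<open>g n - f\<close> there.\<close>

lemma tendsto_higher_deriv_uniform:
  fixes f :: "complex \<Rightarrow> complex"
  assumes "r > 0" and S: "open S" "cball \<zeta> (2 * r) \<subseteq> S"
    and f: "f holomorphic_on S" and g: "\<And>n. g n holomorphic_on S"
    and lim: "uniform_limit (cball \<zeta> (2 * r)) g f sequentially" and z: "z \<longlonglongrightarrow> \<zeta>"
  shows "(\<lambda>n. (deriv ^^ k) (g n) (z n)) \<longlonglongrightarrow> (deriv ^^ k) f \<zeta>"
proof -
  have mem: "\<zeta> \<in> S"
    using S(2) \<open>r > 0\<close> by (auto simp: subset_iff)
  have "(\<lambda>n. (deriv ^^ k) (g n) (z n) - (deriv ^^ k) f (z n)) \<longlonglongrightarrow> 0"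
  proof (rule tendstoI)
    fix e :: real assume e: "e > 0"
    \<comment> \<open>Chosen so that Cauchy's bound \<open>fact k * d / r ^ k\<close> equals
      \<open>e / 2\<close>.\<close>
    define d where "d = e * r ^ k / (2 * fact k)"
    have d: "d > 0" "fact k * d / r ^ k < e"
      using e \<open>r > 0\<close> by (auto simp: d_def)
    have "\<forall>\<^sub>F n in sequentially. \<forall>x\<in>cball \<zeta> (2 * r). dist (g n x) (f x) < d"
      using lim d(1) by (rule uniform_limitD)
    moreover have "\<forall>\<^sub>F n in sequentially. dist (z n) \<zeta> < r"
      using z \<open>r > 0\<close> by (rule tendstoD)
    ultimately show "\<forall>\<^sub>F n in sequentially. dist ((deriv ^^ k) (g n) (z n) - (deriv ^^ k) f (z n)) 0 < e"
    proof eventually_elim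
      case (elim n)
      have sub: "cball (z n) r \<subseteq> cball \<zeta> (2 * r)"
      proof
        fix w assume "w \<in> cball (z n) r"
        then show "w \<in> cball \<zeta> (2 * r)"
          using elim(2) dist_triangle[of \<zeta> w "z n"] by (simp add: dist_commute)
      qed
      have zS: "z n \<in> S"
        using sub S(2) \<open>r > 0\<close> centre_in_cball[of "z n" r] by force
      have hol: "(\<lambda>w. g n w - f w) holomorphic_on S"
        by (intro holomorphic_intros f g)
      have "norm ((deriv ^^ k) (\<lambda>w. g n w - f w) (z n)) \<le> fact k * d / r ^ k"
      proof (rule Cauchy_inequality)
        show "(\<lambda>w. g n w - f w) holomorphic_on ball (z n) r"
          using sub S(2) ball_subset_cball by (intro holomorphic_on_subset[OF hol]) blast
        show "continuous_on (cball (z n) r) (\<lambda>w. g n w - f w)"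
          using sub S(2) by (intro holomorphic_on_imp_continuous_on holomorphic_on_subset[OF hol]) blast
        show "norm (g n x - f x) \<le> d" if "norm (z n - x) = r" for x
          using elim(1) sub that by (force simp: dist_norm subset_iff)
      qed fact
      then show ?case
        using d(2) by (simp add: higher_deriv_diff[OF g f S(1) zS])
    qed
  qed
  moreover have "(\<lambda>n. (deriv ^^ k) f (z n)) \<longlonglongrightarrow> (deriv ^^ k) f \<zeta>"
  proof (rule isCont_tendsto_compose[OF _ z])
    have "continuous_on S ((deriv ^^ k) f)"
      by (intro holomorphic_on_imp_continuous_on holomorphic_higher_deriv f S)
    then show "isCont ((deriv ^^ k) f) \<zeta>"
      using S(1) mem by (simp add: continuous_on_eq_continuous_at)
  qed
  ultimately show ?thesis
    using tendsto_add by fastforce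
qed

text \<open>Formulated through \<open>pade_num\<close> and \<open>pade_den\<close> instead of the
  definite description in \<open>pade\<close>: each clause is an open condition on the Taylor
  coefficients, the points and the value of \<open>f\<close>.\<close>

definition pade_close :: "nat \<Rightarrow> nat \<Rightarrow> complex set \<Rightarrow> real \<Rightarrow> (complex \<Rightarrow> complex) \<Rightarrow> bool" where
  "pade_close p q K s f \<longleftrightarrow> (\<forall>\<zeta>\<in>K. \<forall>z\<in>K. let a = fps_expansion f \<zeta> in pade_regular a p q \<and>
     poly (pade_den a p q) (z - \<zeta>) \<noteq> 0 \<and>
     cmod (poly (pade_num a p q) (z - \<zeta>) / poly (pade_den a p q) (z - \<zeta>) - f z) < s)"

text \<open>Otherwise functions converging to \<open>f\<close> have pairs (centre, point) in
  \<open>K \<times> K\<close> violating the condition. A subsequence of these pairs converges, and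
  at the limit pair the nonvanishing and the strict inequality hold for \<open>f\<close>, so they
  persist along the subsequence.\<close>

lemma hol_open_pade_close:
  assumes \<Omega>: "open \<Omega>" and K: "compact K" "K \<subseteq> \<Omega>"
  shows "hol_open \<Omega> {f \<in> hol_space \<Omega>. pade_close p q K s f}"
  unfolding hol_open_def
proof (intro conjI ballI)
  fix f assume f: "f \<in> {f \<in> hol_space \<Omega>. pade_close p q K s f}"
  then have holf: "f holomorphic_on \<Omega>"
    by (simp add: hol_space_def)
  obtain e where e: "e > 0" "(\<Union>x\<in>K. cball x e) \<subseteq> \<Omega>"
    using compact_subset_open_imp_cball_epsilon_subset[OF K(1) \<Omega> K(2)] by blast
  \<comment> \<open>Closeness on \<open>K\<close> alone does not control derivatives at boundary
    points of \<open>K\<close>; the collar of width \<open>e\<close> makes room for Cauchy's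
    estimate with \<open>r = e / 2\<close>.\<close>
  define L where "L = (\<Union>x\<in>K. cball x e)"
  have L: "compact L" "L \<subseteq> \<Omega>"
    unfolding L_def using compact_minkowski_sum_cball[OF K(1)] e(2) by auto
  show "\<exists>K' d. compact K' \<and> K' \<subseteq> \<Omega> \<and> d > 0 \<and>
      {g \<in> hol_space \<Omega>. \<forall>z\<in>K'. dist (g z) (f z) < d} \<subseteq> {f \<in> hol_space \<Omega>. pade_close p q K s f}"
  proof (rule ccontr)
    assume not: "\<not> ?thesis"
    have "\<exists>g. g \<in> hol_space \<Omega> \<and> (\<forall>z\<in>L. dist (g z) (f z) < 1 / real (Suc n)) \<and> \<not> pade_close p q K s g" for n
    proof (rule ccontr)
      assume "\<nexists>g. g \<in> hol_space \<Omega> \<and> (\<forall>z\<in>L. dist (g z) (f z) < 1 / real (Suc n)) \<and> \<not> pade_close p q K s g"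
      then have "{g \<in> hol_space \<Omega>. \<forall>z\<in>L. dist (g z) (f z) < 1 / real (Suc n)} \<subseteq> {f \<in> hol_space \<Omega>. pade_close p q K s f}"
        by blast
      moreover have "1 / real (Suc n) > 0"
        by simp
      ultimately show False
        using not L by blast
    qed
    then obtain g where g: "\<And>n. g n \<in> hol_space \<Omega>" "\<And>n z. z \<in> L \<Longrightarrow> dist (g n z) (f z) < 1 / real (Suc n)"
        "\<And>n. \<not> pade_close p q K s (g n)"
      by metis
    define bad where "bad = (\<lambda>h \<zeta> z. \<not> (pade_regular (fps_expansion h \<zeta>) p q \<and>
       poly (pade_den (fps_expansion h \<zeta>) p q) (z - \<zeta>) \<noteq> 0 \<and>
       cmod (poly (pade_num (fps_expansion h \<zeta>) p q) (z - \<zeta>) / poly (pade_den (fps_expansion h \<zeta>) p q) (z - \<zeta>) - h z) < s))"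
    have "\<exists>x\<in>K \<times> K. bad (g n) (fst x) (snd x)" for n
      using g(3)[of n] unfolding pade_close_def bad_def Let_def by force
    then obtain x where x: "\<And>n. x n \<in> K \<times> K" "\<And>n. bad (g n) (fst (x n)) (snd (x n))"
      by metis
    have "compact (K \<times> K)"
      using K(1) by (intro compact_Times)
    then obtain l \<rho> where l: "l \<in> K \<times> K" "strict_mono \<rho>" "(x \<circ> \<rho>) \<longlonglongrightarrow> l"
      using x(1) unfolding compact_def by metis
    define h where "h = g \<circ> \<rho>"
    define Z where "Z = (\<lambda>n. fst (x (\<rho> n)))"
    define W where "W = (\<lambda>n. snd (x (\<rho> n)))"
    define \<zeta> where "\<zeta> = fst l"
    define z where "z = snd l"
    have in_K: "\<zeta> \<in> K" "z \<in> K" "Z n \<in> K" "W n \<in> K" for n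
      using l(1) x(1)[of "\<rho> n"] by (auto simp: \<zeta>_def z_def Z_def W_def mem_Times_iff)
    have lim: "Z \<longlonglongrightarrow> \<zeta>" "W \<longlonglongrightarrow> z"
      using tendsto_fst[OF l(3)] tendsto_snd[OF l(3)] by (simp_all add: Z_def W_def \<zeta>_def z_def o_def)
    have holh: "h n holomorphic_on \<Omega>" for n
      using g(1) by (simp add: h_def hol_space_def)
    have "uniform_limit L g f sequentially"
    proof (rule uniform_limitI)
      fix d :: real assume "d > 0"
      then have "\<forall>\<^sub>F n in sequentially. 1 / real (Suc n) < d"
        using order_tendstoD(2)[OF LIMSEQ_inverse_real_of_nat] by (simp add: inverse_eq_divide)
      then show "\<forall>\<^sub>F n in sequentially. \<forall>x\<in>L. dist (g n x) (f x) < d"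
        by eventually_elim (blast intro: less_trans g(2))
    qed
    then have uL: "uniform_limit L h f sequentially"
      using filterlim_subseq[OF l(2)] unfolding h_def o_def by (rule filterlim_compose)
    have "(\<lambda>n. fps_nth (fps_expansion (h n) (Z n)) k) \<longlonglongrightarrow> fps_nth (fps_expansion f \<zeta>) k" for k
    proof -
      have sub: "cball \<zeta> (2 * (e / 2)) \<subseteq> L"
        using in_K(1) by (auto simp: L_def)
      have "(\<lambda>n. (deriv ^^ k) (h n) (Z n)) \<longlonglongrightarrow> (deriv ^^ k) f \<zeta>"
        by (rule tendsto_higher_deriv_uniform[OF _ \<Omega> _ holf holh uniform_limit_on_subset[OF uL sub] lim(1)])
           (use e(1) sub L(2) in auto)
      then show ?thesis
        unfolding fps_expansion_def fps_nth_Abs_fps by (intro tendsto_divide tendsto_const) auto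
    qed
    note coeffs = this
    have wlim: "(\<lambda>n. W n - Z n) \<longlonglongrightarrow> z - \<zeta>"
      by (intro tendsto_intros lim)
    have good: "pade_regular (fps_expansion f \<zeta>) p q" "poly (pade_den (fps_expansion f \<zeta>) p q) (z - \<zeta>) \<noteq> 0"
       "cmod (poly (pade_num (fps_expansion f \<zeta>) p q) (z - \<zeta>) / poly (pade_den (fps_expansion f \<zeta>) p q) (z - \<zeta>) - f z) < s"
      using f in_K(1,2) unfolding pade_close_def Let_def by auto
    have hW: "(\<lambda>n. h n (W n)) \<longlonglongrightarrow> f z"
    proof -
      have "(\<lambda>n. h n (W n) - f (W n)) \<longlonglongrightarrow> 0"
      proof (rule tendstoI)
        fix d :: real assume "d > 0"
        have "W n \<in> L" for n
          using in_K(4)[of n] e(1) by (force simp: L_def)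
        with uniform_limitD[OF uL \<open>d > 0\<close>] show "\<forall>\<^sub>F n in sequentially. dist (h n (W n) - f (W n)) 0 < d"
          by (auto elim!: eventually_mono simp: dist_norm)
      qed
      moreover have "(\<lambda>n. f (W n)) \<longlonglongrightarrow> f z"
        using in_K(2,4) K(2)
        by (intro continuous_on_tendsto_compose[OF holomorphic_on_imp_continuous_on[OF holf] lim(2)] always_eventually) auto
      ultimately show ?thesis
        using tendsto_add by fastforce
    qed
    have "\<forall>\<^sub>F n in sequentially. Determinant.det (hankel_mat (fps_expansion (h n) (Z n)) p q) \<noteq> 0"
      using tendsto_hankel_det[OF coeffs] good(1) unfolding pade_regular_def by (rule tendsto_imp_eventually_ne)
    moreover have "\<forall>\<^sub>F n in sequentially. poly (pade_den (fps_expansion (h n) (Z n)) p q) (W n - Z n) \<noteq> 0"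
      using tendsto_pade_den[OF coeffs wlim] good(2) by (rule tendsto_imp_eventually_ne)
    moreover have "\<forall>\<^sub>F n in sequentially. cmod (poly (pade_num (fps_expansion (h n) (Z n)) p q) (W n - Z n) /
        poly (pade_den (fps_expansion (h n) (Z n)) p q) (W n - Z n) - h n (W n)) < s"
      by (rule order_tendstoD(2)[OF _ good(3)])
         (intro tendsto_intros tendsto_pade_den[OF coeffs wlim] tendsto_pade_num[OF coeffs wlim] hW good(2))
    ultimately have "\<forall>\<^sub>F n in sequentially. \<not> bad (h n) (Z n) (W n)"
      by eventually_elim (simp add: bad_def pade_regular_def)
    moreover have "bad (h n) (Z n) (W n)" for n
      using x(2)[of "\<rho> n"] by (simp add: h_def Z_def W_def)
    ultimately show False
      by simp
  qed
qed simp

section \<open>Universality as a countable intersection\<close>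

lemma exhaust_compact_cofinal:
  assumes "open \<Omega>" "compact K" "K \<subseteq> \<Omega>"
  shows "\<exists>N. \<forall>n\<ge>N. K \<subseteq> exhaust_compact \<Omega> n"
proof -
  obtain N where "K \<subseteq> exhaust_compact \<Omega> N"
    using compact_subset_exhaust_compact[OF assms] by blast
  then have "K \<subseteq> exhaust_compact \<Omega> n" if "n \<ge> N" for n
    using exhaust_compact_mono[OF that] by (rule order_trans)
  then show ?thesis
    by blast
qed

text \<open>Every compact subset of \<Omega> lies in all exhausting sets from some index on, so
  countably many sets with tolerances tending to 0 suffice. Conversely, one pair picked for each
  \<open>m\<close> forms the required sequence.\<close>

lemma pade_universal_iff:
  assumes \<Omega>: "open \<Omega>"
  shows "pade_universal F \<Omega> f \<longleftrightarrow>
    (\<forall>m. \<exists>(p, q)\<in>F. pade_close p q (exhaust_compact \<Omega> m) (1 / real (Suc m)) f)"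
proof
  assume "pade_universal F \<Omega> f"
  then obtain p q where F: "\<forall>n. (p n, q n) \<in> F"
    and pq: "\<forall>K. compact K \<and> K \<subseteq> \<Omega> \<longrightarrow> (\<exists>N. \<forall>n\<ge>N. \<forall>\<zeta>\<in>K. pade_regular (fps_expansion f \<zeta>) (p n) (q n)) \<and>
           (\<lambda>n. SUP \<zeta>\<in>K. SUP z\<in>K. approx_error (pade (fps_expansion f \<zeta>) \<zeta> (p n) (q n)) f z) \<longlonglongrightarrow> 0"
    unfolding pade_universal_def by (elim exE conjE) (rule that)
  show "\<forall>m. \<exists>(p, q)\<in>F. pade_close p q (exhaust_compact \<Omega> m) (1 / real (Suc m)) f"
  proof
    fix m
    let ?K = "exhaust_compact \<Omega> m"
    obtain N where N: "\<forall>n\<ge>N. \<forall>\<zeta>\<in>?K. pade_regular (fps_expansion f \<zeta>) (p n) (q n)"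
      and lim: "(\<lambda>n. SUP \<zeta>\<in>?K. SUP z\<in>?K. approx_error (pade (fps_expansion f \<zeta>) \<zeta> (p n) (q n)) f z) \<longlonglongrightarrow> 0"
      using mp[OF spec[OF pq, of ?K] conjI[OF compact_exhaust_compact exhaust_compact_subset]]
      by (elim exE conjE) (rule that)
    have "\<forall>\<^sub>F n in sequentially. (SUP \<zeta>\<in>?K. SUP z\<in>?K. approx_error (pade (fps_expansion f \<zeta>) \<zeta> (p n) (q n)) f z) < ennreal (1 / real (Suc m))"
      by (rule order_tendstoD(2)[OF lim]) simp
    then have "\<forall>\<^sub>F n in sequentially. (SUP \<zeta>\<in>?K. SUP z\<in>?K. approx_error (pade (fps_expansion f \<zeta>) \<zeta> (p n) (q n)) f z) < ennreal (1 / real (Suc m)) \<and> n \<ge> N"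
      by (intro eventually_conj eventually_ge_at_top)
    then obtain n where n: "n \<ge> N" "(SUP \<zeta>\<in>?K. SUP z\<in>?K. approx_error (pade (fps_expansion f \<zeta>) \<zeta> (p n) (q n)) f z) < ennreal (1 / real (Suc m))"
      unfolding eventually_sequentially by blast
    have "pade_close (p n) (q n) ?K (1 / real (Suc m)) f"
      unfolding pade_close_def Let_def
    proof (intro ballI)
      fix \<zeta> z assume *: "\<zeta> \<in> ?K" "z \<in> ?K"
      note reg = N[rule_format, OF n(1) *(1)]
      \<comment> \<open>A finite bound on the supremum excludes the value infinity, that is, a zero
        of the denominator.\<close>
      have "approx_error (pade (fps_expansion f \<zeta>) \<zeta> (p n) (q n)) f z \<le>
          (SUP \<zeta>\<in>?K. SUP z\<in>?K. approx_error (pade (fps_expansion f \<zeta>) \<zeta> (p n) (q n)) f z)"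
        using * by (intro SUP_upper2[of \<zeta>] SUP_upper)
      also note n(2)
      finally show "pade_regular (fps_expansion f \<zeta>) (p n) (q n) \<and>
          poly (pade_den (fps_expansion f \<zeta>) (p n) (q n)) (z - \<zeta>) \<noteq> 0 \<and>
          cmod (poly (pade_num (fps_expansion f \<zeta>) (p n) (q n)) (z - \<zeta>) / poly (pade_den (fps_expansion f \<zeta>) (p n) (q n)) (z - \<zeta>) - f z) < 1 / real (Suc m)"
        using reg by (auto simp: approx_error_pade[OF reg] ennreal_less_iff split: if_splits)
    qed
    then show "\<exists>(p, q)\<in>F. pade_close p q ?K (1 / real (Suc m)) f"
      using F by blast
  qed
next
  assume "\<forall>m. \<exists>(p, q)\<in>F. pade_close p q (exhaust_compact \<Omega> m) (1 / real (Suc m)) f"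
  then have "\<forall>m. \<exists>x. x \<in> F \<and> pade_close (fst x) (snd x) (exhaust_compact \<Omega> m) (1 / real (Suc m)) f"
    by fastforce
  then have "\<exists>x. \<forall>m. x m \<in> F \<and> pade_close (fst (x m)) (snd (x m)) (exhaust_compact \<Omega> m) (1 / real (Suc m)) f"
    by (rule choice)
  then obtain x where "\<forall>m. x m \<in> F \<and> pade_close (fst (x m)) (snd (x m)) (exhaust_compact \<Omega> m) (1 / real (Suc m)) f" ..
  then have x: "\<And>m. x m \<in> F" "\<And>m. pade_close (fst (x m)) (snd (x m)) (exhaust_compact \<Omega> m) (1 / real (Suc m)) f"
    by blast+
  show "pade_universal F \<Omega> f"
    unfolding pade_universal_def
  proof (rule exI[of _ "fst \<circ> x"], rule exI[of _ "snd \<circ> x"], intro conjI allI impI)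
    show "((fst \<circ> x) n, (snd \<circ> x) n) \<in> F" for n
      using x(1) by simp
    fix K assume K: "compact K \<and> K \<subseteq> \<Omega>"
    then obtain N where N: "\<And>n. n \<ge> N \<Longrightarrow> K \<subseteq> exhaust_compact \<Omega> n"
      using exhaust_compact_cofinal[OF \<Omega>] by blast
    have reg: "pade_regular (fps_expansion f \<zeta>) (fst (x n)) (snd (x n))" if "n \<ge> N" "\<zeta> \<in> K" for n \<zeta>
      using x(2)[of n] N[OF that(1)] that(2) unfolding pade_close_def Let_def by blast
    then show "\<exists>N. \<forall>n\<ge>N. \<forall>\<zeta>\<in>K. pade_regular (fps_expansion f \<zeta>) ((fst \<circ> x) n) ((snd \<circ> x) n)"
      by auto
    show "(\<lambda>n. SUP \<zeta>\<in>K. SUP z\<in>K. approx_error (pade (fps_expansion f \<zeta>) \<zeta> ((fst \<circ> x) n) ((snd \<circ> x) n)) f z) \<longlonglongrightarrow> 0"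
    proof (rule tendsto_sandwich[OF _ _ tendsto_const])
      show "(\<lambda>n. ennreal (1 / real (Suc n))) \<longlonglongrightarrow> 0"
        using tendsto_ennrealI[OF LIMSEQ_inverse_real_of_nat] by (simp add: inverse_eq_divide)
      have "(SUP \<zeta>\<in>K. SUP z\<in>K. approx_error (pade (fps_expansion f \<zeta>) \<zeta> ((fst \<circ> x) n) ((snd \<circ> x) n)) f z) \<le> ennreal (1 / real (Suc n))"
        if n: "n \<ge> N" for n
      proof (intro SUP_least)
        fix \<zeta> z assume *: "\<zeta> \<in> K" "z \<in> K"
        then have "\<zeta> \<in> exhaust_compact \<Omega> n" "z \<in> exhaust_compact \<Omega> n"
          using N[OF n] by auto
        with x(2)[of n] show "approx_error (pade (fps_expansion f \<zeta>) \<zeta> ((fst \<circ> x) n) ((snd \<circ> x) n)) f z \<le> ennreal (1 / real (Suc n))"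
          using reg[OF n *(1)] unfolding pade_close_def Let_def
          by (auto simp: approx_error_pade intro!: ennreal_leI less_imp_le)
      qed
      then show "\<forall>\<^sub>F n in sequentially. (SUP \<zeta>\<in>K. SUP z\<in>K. approx_error (pade (fps_expansion f \<zeta>) \<zeta> ((fst \<circ> x) n) ((snd \<circ> x) n)) f z) \<le> ennreal (1 / real (Suc n))"
        unfolding eventually_sequentially by blast
    qed auto
  qed
qed

section \<open>Density via exactly reproduced rational functions\<close>

text \<open>A Bezout identity survives substitution.\<close>

lemma coprime_pcompose_linear:
  fixes P Q :: "complex poly"
  assumes "coprime P Q"
  shows "coprime (P \<circ>\<^sub>p [:c, 1:]) (Q \<circ>\<^sub>p [:c, 1:])"
proof -
  obtain u v where uv: "u * P + v * Q = 1"
    using assms bezout_coefficients_fst_snd[of P Q] by (metis coprime_iff_gcd_eq_1)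
  have "(u \<circ>\<^sub>p [:c, 1:]) * (P \<circ>\<^sub>p [:c, 1:]) + (v \<circ>\<^sub>p [:c, 1:]) * (Q \<circ>\<^sub>p [:c, 1:]) = 1"
    using arg_cong[OF uv, of "\<lambda>p. p \<circ>\<^sub>p [:c, 1:]"] by (simp add: pcompose_add pcompose_mult pcompose_1)
  then show ?thesis
    by (intro coprimeI) (metis dvd_add dvd_mult)
qed

text \<open>Re-expanding \<open>A\<close> and \<open>B\<close> about the centre preserves degrees
  and coprimality, so \<open>f\<close> is regular there. As \<open>A / B\<close> solves the Pade
  problem exactly, the error is 0 and any positive \<open>s\<close> works.\<close>

lemma pade_close_rational:
  fixes A B :: "complex poly"
  assumes \<Omega>: "open \<Omega>" and f: "f holomorphic_on \<Omega>" "\<And>z. z \<in> \<Omega> \<Longrightarrow> poly B z \<noteq> 0" "\<And>z. z \<in> \<Omega> \<Longrightarrow> f z = poly A z / poly B z"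
    and AB: "coprime A B" "A \<noteq> 0" "Polynomial.degree A = p" "Polynomial.degree B \<le> q"
    and "K \<subseteq> \<Omega>" "s > 0"
  shows "pade_close p q K s f"
  unfolding pade_close_def Let_def
proof (intro ballI)
  fix \<zeta> z assume "\<zeta> \<in> K" "z \<in> K"
  then have mem: "\<zeta> \<in> \<Omega>" "z \<in> \<Omega>"
    using \<open>K \<subseteq> \<Omega>\<close> by auto
  let ?a = "fps_expansion f \<zeta>"
  define A' where "A' = A \<circ>\<^sub>p [:\<zeta>, 1:]"
  define B' where "B' = B \<circ>\<^sub>p [:\<zeta>, 1:]"
  have poly': "poly A' w = poly A (\<zeta> + w)" "poly B' w = poly B (\<zeta> + w)" for w
    by (simp_all add: A'_def B'_def poly_pcompose)
  have exp: "fps_of_poly B' * ?a = fps_of_poly A'"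
  proof (rule fps_of_poly_mult_fps_expansion)
    show "f analytic_on {\<zeta>}"
      using \<Omega> f(1) mem(1) by (metis analytic_at)
    have "\<forall>\<^sub>F w in nhds \<zeta>. w \<in> \<Omega>"
      using \<Omega> mem(1) by (rule eventually_nhds_in_open)
    then show "\<forall>\<^sub>F w in nhds \<zeta>. poly B' (w - \<zeta>) * f w = poly A' (w - \<zeta>)"
      by eventually_elim (simp add: poly' f(2,3))
  qed
  have deg: "Polynomial.degree A' = p" "Polynomial.degree B' \<le> q"
    using AB(3,4) by (simp_all add: A'_def B'_def degree_pcompose)
  have B0: "Polynomial.coeff B' 0 \<noteq> 0"
    using f(2)[OF mem(1)] poly'(2)[of 0] by (simp add: poly_0_coeff_0)
  have "A' \<noteq> 0"
    using AB(2) by (simp add: A'_def pcompose_eq_0_iff)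
  moreover have "coprime A' B'"
    unfolding A'_def B'_def using AB(1) by (rule coprime_pcompose_linear)
  ultimately have reg: "pade_regular ?a p q"
    using deg B0 exp by (intro pade_regular_rational)
  let ?d = "Determinant.det (hankel_mat ?a p q)"
  have d: "?d \<noteq> 0"
    using reg by (simp add: pade_regular_def)
  have "lin_pade ?a p q A' B'"
    using deg exp by (intro lin_pade_rational) auto
  \<comment> \<open>The shifted \<open>A'\<close>, \<open>B'\<close> and the determinant formulas
    are proportional with a common factor, so their quotients agree at \<open>z\<close>.\<close>
  note uniq = lin_pade_unique[OF this, THEN arg_cong[where f = "\<lambda>p. poly p (z - \<zeta>)"], unfolded poly_smult]
  have "poly B z \<noteq> 0" "f z = poly A z / poly B z"
    using f(2,3) mem(2) by auto
  moreover have "?d * poly B z = Polynomial.coeff B' 0 * poly (pade_den ?a p q) (z - \<zeta>)"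
    "?d * poly A z = Polynomial.coeff B' 0 * poly (pade_num ?a p q) (z - \<zeta>)"
    using uniq by (simp_all add: poly')
  ultimately have den: "poly (pade_den ?a p q) (z - \<zeta>) \<noteq> 0"
    using d by auto
  moreover have "poly (pade_num ?a p q) (z - \<zeta>) / poly (pade_den ?a p q) (z - \<zeta>) =
      (Polynomial.coeff B' 0 * poly (pade_num ?a p q) (z - \<zeta>)) / (Polynomial.coeff B' 0 * poly (pade_den ?a p q) (z - \<zeta>))"
    using B0 by simp
  moreover have "\<dots> = (?d * poly A z) / (?d * poly B z)"
    using uniq by (simp add: poly')
  moreover have "\<dots> = f z"
    using d f(3)[OF mem(2)] by simp
  ultimately show "pade_regular ?a p q \<and> poly (pade_den ?a p q) (z - \<zeta>) \<noteq> 0 \<and>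
     cmod (poly (pade_num ?a p q) (z - \<zeta>) / poly (pade_den ?a p q) (z - \<zeta>) - f z) < s"
    using reg \<open>s > 0\<close> by simp
qed

lemma rational_on_coprime:
  assumes "r \<in> rational_on \<Omega>"
  obtains P Q where "coprime P Q" "Q \<noteq> 0" "\<And>z. z \<in> \<Omega> \<Longrightarrow> poly Q z \<noteq> 0" "\<And>z. z \<in> \<Omega> \<Longrightarrow> r z = poly P z / poly Q z"
proof (cases "\<Omega> = {}")
  case True
  \<comment> \<open>On the empty set the given denominator may be the zero polynomial, so a fresh
    fraction is supplied.\<close>
  then show ?thesis
    by (intro that[of 1 1]) auto
next
  case False
  obtain P Q where PQ: "\<And>z. z \<in> \<Omega> \<Longrightarrow> poly Q z \<noteq> 0" "\<And>z. z \<in> \<Omega> \<Longrightarrow> r z = poly P z / poly Q z"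
    using assms unfolding rational_on_def by blast
  with False have "Q \<noteq> 0"
    by fastforce
  then have "gcd P Q \<noteq> 0"
    by simp
  from gcd_coprime_exists[OF this] obtain P' Q' where *: "P = P' * gcd P Q" "Q = Q' * gcd P Q" "coprime P' Q'"
    by blast
  have "poly Q' z \<noteq> 0" "poly (gcd P Q) z \<noteq> 0" if "z \<in> \<Omega>" for z
    using PQ(1)[OF that] * by (metis poly_mult mult_zero_left mult_zero_right)+
  moreover have "r z = poly P' z / poly Q' z" if "z \<in> \<Omega>" for z
    using PQ(2)[OF that] * calculation(2)[OF that] by (metis poly_mult mult_divide_mult_cancel_right)
  moreover have "Q' \<noteq> 0"
    using * \<open>Q \<noteq> 0\<close> by auto
  ultimately show ?thesis
    using *(3) that by blast
qed

lemma hol_openE: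
  assumes "hol_open \<Omega> V" "g \<in> V"
  obtains L e where "compact L" "L \<subseteq> \<Omega>" "e > 0" "{h \<in> hol_space \<Omega>. \<forall>z\<in>L. dist (h z) (g z) < e} \<subseteq> V"
  using assms unfolding hol_open_def by blast

lemma pade_close_dense:
  fixes pt qt :: "nat \<Rightarrow> nat"
  assumes \<Omega>: "open \<Omega>" and F: "\<And>n. n \<ge> 1 \<Longrightarrow> (pt n, qt n) \<in> F"
    and pt: "filterlim pt at_top sequentially" and qt: "filterlim qt at_top sequentially"
    and V: "hol_open \<Omega> V" "V \<noteq> {}" and K: "K \<subseteq> \<Omega>" and s: "s > 0"
  shows "\<exists>f\<in>V. \<exists>(p, q)\<in>F. pade_close p q K s f"
proof -
  obtain g where g: "g \<in> V"
    using V(2) by blast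
  then have holg: "g holomorphic_on \<Omega>"
    using V(1) by (auto simp: hol_open_def hol_space_def)
  obtain L e where L: "compact L" "L \<subseteq> \<Omega>" "e > 0" "{h \<in> hol_space \<Omega>. \<forall>z\<in>L. dist (h z) (g z) < e} \<subseteq> V"
    using hol_openE[OF V(1) g] by blast
  obtain M where M: "L \<subseteq> exhaust_compact \<Omega> M"
    using compact_subset_exhaust_compact[OF \<Omega> L(1,2)] by blast
  \<comment> \<open>One third is spent on Runge's theorem and one on the added monomial; the
    remaining third makes the final inequality strict.\<close>
  have "e / 3 > 0"
    using L(3) by simp
  then obtain r where r: "r \<in> rational_on \<Omega>" "\<And>z. z \<in> exhaust_compact \<Omega> M \<Longrightarrow> dist (g z) (r z) \<le> e / 3"
    using Runge_exhaust_compact[OF \<Omega> holg, of M] unfolding unif_closure_def by blast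
  obtain P Q where PQ: "coprime P Q" "Q \<noteq> 0" "\<And>z. z \<in> \<Omega> \<Longrightarrow> poly Q z \<noteq> 0" "\<And>z. z \<in> \<Omega> \<Longrightarrow> r z = poly P z / poly Q z"
    using rational_on_coprime[OF r(1)] by blast
  let ?d = "Polynomial.degree Q"
  have "\<forall>\<^sub>F n in sequentially. pt n \<ge> ?d + Polynomial.degree P + 1 \<and> qt n \<ge> ?d \<and> n \<ge> 1"
    using pt qt by (auto simp: filterlim_at_top intro!: eventually_conj eventually_ge_at_top)
  \<comment> \<open>The first bound lets the monomial term determine the degree of the numerator,
    the second fits the denominator in, and the third is the range in which the pairs belong to
    \<open>F\<close>.\<close>
  then obtain n where n: "pt n \<ge> ?d + Polynomial.degree P + 1" "qt n \<ge> ?d" "n \<ge> 1"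
    unfolding eventually_sequentially by blast
  define k where "k = pt n - ?d"
  \<comment> \<open>Makes \<open>c * norm z ^ k\<close> at most \<open>e / 3\<close> where
    \<open>norm z \<le> M\<close>; using \<open>M + 1\<close> avoids a zero divisor when
    \<open>M = 0\<close>.\<close>
  define c where "c = e / (3 * (real M + 1) ^ k)"
  have c: "c > 0"
    using L(3) by (simp add: c_def)
  define A where "A = P + Polynomial.monom (of_real c) k * Q"
  have mne: "Polynomial.monom (of_real c :: complex) k \<noteq> 0"
    using c by (simp add: monom_eq_0_iff)
  have "Polynomial.degree (Polynomial.monom (of_real c) k * Q) = pt n"
    using mne PQ(2) n(1) c by (simp add: Polynomial.degree_mult_eq Polynomial.degree_monom_eq k_def)
  then have degA: "Polynomial.degree A = pt n"
    unfolding A_def using n(1) by (subst Polynomial.degree_add_eq_right) auto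
  then have "A \<noteq> 0"
    using n(1) by auto
  have "coprime A Q"
  proof -
    have "gcd Q A = gcd Q P"
      unfolding A_def add.commute[of P] by (rule gcd_add_mult)
    then show ?thesis
      using PQ(1) by (simp add: coprime_iff_gcd_eq_1 gcd.commute)
  qed
  define f where "f = restrict (\<lambda>z. poly A z / poly Q z) \<Omega>"
  have feq: "f z = r z + of_real c * z ^ k" if "z \<in> \<Omega>" for z
    using that PQ(3,4)[OF that] by (simp add: f_def A_def poly_monom field_simps)
  have "(\<lambda>z. poly A z / poly Q z) holomorphic_on \<Omega>"
    using PQ(3) by (intro holomorphic_intros) auto
  then have holf: "f holomorphic_on \<Omega>"
    by (rule holomorphic_transform) (simp add: f_def)
  then have "f \<in> hol_space \<Omega>"
    by (simp add: hol_space_def f_def)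
  moreover have "dist (f z) (g z) < e" if "z \<in> L" for z
  proof -
    have z: "z \<in> exhaust_compact \<Omega> M" "z \<in> \<Omega>"
      using that M L(2) by auto
    have "norm z ^ k \<le> (real M + 1) ^ k"
      using z(1) by (intro power_mono) (auto simp: exhaust_compact_def)
    then have "c * norm z ^ k \<le> c * (real M + 1) ^ k"
      using c by (intro mult_left_mono) auto
    also have "\<dots> = e / 3"
      by (simp add: c_def add_nonneg_eq_0_iff)
    finally have "dist (f z) (r z) \<le> e / 3"
      using c by (simp add: feq[OF z(2)] dist_norm norm_mult norm_power)
    moreover have "dist (r z) (g z) \<le> e / 3"
      using r(2)[OF z(1)] by (simp add: dist_commute)
    ultimately show ?thesis
      using dist_triangle[of "f z" "g z" "r z"] L(3) by linarith
  qed
  ultimately have "f \<in> V"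
    using L(4) by blast
  moreover have "pade_close (pt n) (qt n) K s f"
    by (rule pade_close_rational[OF \<Omega> holf PQ(3) _ \<open>coprime A Q\<close> \<open>A \<noteq> 0\<close> degA n(2) K s]) (auto simp: f_def)
  ultimately show ?thesis
    using F[OF n(3)] by blast
qed

section \<open>Baire category for holomorphic functions\<close>

text \<open>Nested closed balls, carried out with the basic neighbourhoods themselves. The compact
  sets grow and the radii shrink, so the centres are uniformly Cauchy on every exhausting set. The
  limit is holomorphic by Weierstrass and lies in each ball since these are defined by non-strict
  inequalities.\<close>

lemma hol_space_Baire:
  assumes \<Omega>: "open \<Omega>" and U: "\<And>n :: nat. hol_open \<Omega> (U n)"
    and dense: "\<And>n V. hol_open \<Omega> V \<Longrightarrow> V \<noteq> {} \<Longrightarrow> V \<inter> U n \<noteq> {}"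
    and W: "hol_open \<Omega> W" "W \<noteq> {}"
  shows "\<exists>f\<in>W. \<forall>n. f \<in> U n"
proof -
  let ?K = "exhaust_compact \<Omega>"
  \<comment> \<open>A ball is coded by its centre, the index of the compact set and the
    radius.\<close>
  define B where "B = (\<lambda>x :: (complex \<Rightarrow> complex) \<times> nat \<times> real. 
     {h \<in> hol_space \<Omega>. \<forall>z\<in>?K (fst (snd x)). dist (h z) (fst x z) \<le> snd (snd x)})"
  define good where "good = (\<lambda>(n :: nat) (x :: (complex \<Rightarrow> complex) \<times> nat \<times> real). 
     fst x \<in> hol_space \<Omega> \<and> n \<le> fst (snd x) \<and> 0 < snd (snd x) \<and> snd (snd x) \<le> 1 / real (Suc n) \<and> B x \<subseteq> W \<inter> U n)"
  have ball: "\<exists>x. good n x \<and> B x \<subseteq> V" if V: "hol_open \<Omega> V" "V \<noteq> {}" "V \<subseteq> W" for V n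
  proof -
    have "hol_open \<Omega> (V \<inter> U n)"
      using V(1) U[of n] istopology_hol_open by (simp add: istopology_def)
    moreover obtain f where f: "f \<in> V \<inter> U n"
      using dense[OF V(1,2)] by blast
    ultimately obtain L e where L: "compact L" "L \<subseteq> \<Omega>" "e > 0" "{h \<in> hol_space \<Omega>. \<forall>z\<in>L. dist (h z) (f z) < e} \<subseteq> V \<inter> U n"
      using hol_openE[of \<Omega> "V \<inter> U n" f] by blast
    obtain m where m: "\<And>k. k \<ge> m \<Longrightarrow> L \<subseteq> ?K k"
      using exhaust_compact_cofinal[OF \<Omega> L(1,2)] by blast
    \<comment> \<open>Halving \<open>e\<close> fits a closed ball into the open one. The index and
      the second radius bound enforce the growth and shrinkage demanded by
      \<open>good\<close>.\<close>
    let ?x = "(f, max m n, min (e / 2) (1 / real (Suc n)))"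
    have "B ?x \<subseteq> {h \<in> hol_space \<Omega>. \<forall>z\<in>L. dist (h z) (f z) < e}"
      using m[of "max m n"] L(3) by (force simp: B_def)
    then have "B ?x \<subseteq> V \<inter> U n"
      using L(4) by blast
    moreover have "f \<in> hol_space \<Omega>"
      using f V(1) by (auto simp: hol_open_def)
    ultimately have "good n ?x \<and> B ?x \<subseteq> V"
      using V(3) L(3) by (auto simp: good_def)
    then show ?thesis
      by blast
  qed
  have step: "\<exists>y. good (Suc n) y \<and> B y \<subseteq> B x" if x: "good n x" for n x
  proof -
    \<comment> \<open>An open set inside the closed ball and containing its centre: a margin uniform
      over the compact set leaves room for a perturbation of half its size.\<close>
    define V where "V = {h \<in> hol_space \<Omega>. \<exists>d<snd (snd x). \<forall>z\<in>?K (fst (snd x)). dist (h z) (fst x z) \<le> d}"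
    have VB: "V \<subseteq> B x"
      unfolding V_def B_def by fastforce
    have "hol_open \<Omega> V"
      unfolding hol_open_def
    proof (intro conjI ballI)
      show "V \<subseteq> hol_space \<Omega>"
        by (auto simp: V_def)
      fix h assume "h \<in> V"
      then obtain d where d: "d < snd (snd x)" "\<And>z. z \<in> ?K (fst (snd x)) \<Longrightarrow> dist (h z) (fst x z) \<le> d"
        by (auto simp: V_def)
      let ?e = "(snd (snd x) - d) / 2"
      have "h' \<in> V" if h': "h' \<in> hol_space \<Omega>" "\<forall>z\<in>?K (fst (snd x)). dist (h' z) (h z) < ?e" for h'
      proof -
        have "dist (h' z) (fst x z) \<le> d + ?e" if z: "z \<in> ?K (fst (snd x))" for z
        proof -
          have "dist (h' z) (fst x z) \<le> dist (h' z) (h z) + dist (h z) (fst x z)"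
            by (rule dist_triangle)
          then show ?thesis
            using h'(2)[rule_format, OF z] d(2)[OF z] by linarith
        qed
        moreover have "d + ?e < snd (snd x)"
          using d(1) by (simp add: field_simps)
        ultimately show ?thesis
          using h'(1) unfolding V_def by blast
      qed
      then have "{h' \<in> hol_space \<Omega>. \<forall>z\<in>?K (fst (snd x)). dist (h' z) (h z) < ?e} \<subseteq> V"
        by blast
      moreover have "?e > 0"
        using d(1) by simp
      ultimately show "\<exists>K e. compact K \<and> K \<subseteq> \<Omega> \<and> e > 0 \<and> {g \<in> hol_space \<Omega>. \<forall>z\<in>K. dist (g z) (h z) < e} \<subseteq> V"
        by (intro exI[of _ "?K (fst (snd x))"] exI[of _ ?e] conjI compact_exhaust_compact exhaust_compact_subset)
    qed
    moreover have "fst x \<in> V"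
      using x by (auto simp: V_def good_def intro!: exI[of _ 0])
    moreover have "V \<subseteq> W"
      using VB x by (auto simp: good_def)
    ultimately obtain y where "good (Suc n) y" "B y \<subseteq> V"
      using ball[of V "Suc n"] by blast
    with VB show ?thesis
      by blast
  qed
  have "\<exists>x. good 0 x"
    using ball[OF W] by blast
  then obtain x where x: "\<And>n. good n (x n)" "\<And>n. B (x (Suc n)) \<subseteq> B (x n)"
    using dependent_nat_choice[of good "\<lambda>_ x y. B y \<subseteq> B x"] step by metis
  define f where "f = (\<lambda>n. fst (x n))"
  have fB: "f n \<in> B (x n)" for n
    using x(1)[of n] by (auto simp: good_def B_def f_def)
  have "B (x n) \<subseteq> B (x m)" if "m \<le> n" for m n
    using lift_Suc_antimono_le[of "\<lambda>n. B (x n)"] x(2) that by blast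
  then have fB': "f n \<in> B (x m)" if "m \<le> n" for m n
    using fB that by blast
  have close: "dist (f n z) (f m z) \<le> 1 / real (Suc m)" if "m \<le> n" "k \<le> m" "z \<in> ?K k" for m n k z
  proof -
    have "k \<le> fst (snd (x m))" "snd (snd (x m)) \<le> 1 / real (Suc m)"
      using x(1)[of m] that(2) by (auto simp: good_def)
    then have "z \<in> ?K (fst (snd (x m)))"
      using exhaust_compact_mono that(3) by blast
    then show ?thesis
      using fB'[OF that(1)] \<open>snd (snd (x m)) \<le> 1 / real (Suc m)\<close> by (force simp: B_def f_def)
  qed
  have "uniformly_convergent_on (?K k) f" for k
    unfolding uniformly_convergent_eq_Cauchy
  proof (rule uniformly_Cauchy_onI')
    fix e :: real assume "e > 0"
    then obtain N where N: "1 / real (Suc N) < e"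
      using reals_Archimedean[of e] by (auto simp: inverse_eq_divide)
    have "dist (f m z) (f n z) < e" if "m \<ge> max k N" "n > m" "z \<in> ?K k" for m n z
    proof -
      have "1 / real (Suc m) \<le> 1 / real (Suc N)"
        using that(1) by (intro frac_le) auto
      then show ?thesis
        using close[of m n k z] that N by (simp add: dist_commute)
    qed
    then show "\<exists>M. \<forall>x\<in>?K k. \<forall>m\<ge>M. \<forall>n>m. dist (f m x) (f n x) < e"
      by blast
  qed
  then have ulim: "uniform_limit (?K k) f (\<lambda>z. lim (\<lambda>n. f n z)) sequentially" for k
    by (rule uniformly_convergent_uniform_limit_iff[THEN iffD1])
  define h where "h = restrict (\<lambda>z. lim (\<lambda>n. f n z)) \<Omega>"
  have hlim: "uniform_limit (?K k) f h sequentially" for k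
    using ulim[of k] exhaust_compact_subset[of \<Omega> k]
    by (subst uniform_limit_cong') (auto simp: h_def)
  have "h holomorphic_on \<Omega>"
  proof (rule holomorphic_uniform_sequence[OF \<Omega>])
    show "f n holomorphic_on \<Omega>" for n
      using x(1)[of n] by (auto simp: f_def good_def hol_space_def)
    fix z assume "z \<in> \<Omega>"
    then obtain d where d: "d > 0" "cball z d \<subseteq> \<Omega>"
      using \<Omega> open_contains_cball by blast
    then obtain k where "cball z d \<subseteq> ?K k"
      using compact_subset_exhaust_compact[OF \<Omega>, of "cball z d"] by auto
    then have "uniform_limit (cball z d) f h sequentially"
      using hlim uniform_limit_on_subset by blast
    with d show "\<exists>d>0. cball z d \<subseteq> \<Omega> \<and> uniform_limit (cball z d) f h sequentially"
      by blast
  qed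
  then have hH: "h \<in> hol_space \<Omega>"
    by (simp add: hol_space_def h_def)
  have "h \<in> B (x m)" for m
  proof -
    have "dist (h z) (fst (x m) z) \<le> snd (snd (x m))" if z: "z \<in> ?K (fst (snd (x m)))" for z
    proof (rule tendsto_upperbound)
      show "(\<lambda>n. dist (f n z) (fst (x m) z)) \<longlonglongrightarrow> dist (h z) (fst (x m) z)"
        by (intro tendsto_intros tendsto_uniform_limitI[OF hlim z])
      show "\<forall>\<^sub>F n in sequentially. dist (f n z) (fst (x m) z) \<le> snd (snd (x m))"
        using eventually_ge_at_top[of m] by eventually_elim (use fB' z in \<open>auto simp: B_def\<close>)
    qed simp
    with hH show ?thesis
      by (simp add: B_def)
  qed
  moreover have "B (x m) \<subseteq> W \<inter> U m" for m
    using x(1)[of m] by (simp add: good_def)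
  ultimately show ?thesis
    by blast
qed

theorem theorem5p6:
  fixes \<Omega> :: "complex set" and F :: "(nat \<times> nat) set" and pt qt :: "nat \<Rightarrow> nat"
  assumes "open \<Omega>"
    and "\<And>n. n \<ge> 1 \<Longrightarrow> (pt n, qt n) \<in> F"
    and "filterlim pt at_top sequentially"
    and "filterlim qt at_top sequentially"
  shows "(\<exists>f\<in>hol_space \<Omega>. pade_universal F \<Omega> f) \<and>
         gdelta_in (hol_topology \<Omega>) {f \<in> hol_space \<Omega>. pade_universal F \<Omega> f} \<and>
         hol_topology \<Omega> closure_of {f \<in> hol_space \<Omega>. pade_universal F \<Omega> f} = hol_space \<Omega>"
proof -
  let ?X = "hol_topology \<Omega>" and ?H = "hol_space \<Omega>"
  define U where "U = (\<lambda>m. {f \<in> ?H. \<exists>(p, q)\<in>F. pade_close p q (exhaust_compact \<Omega> m) (1 / real (Suc m)) f})"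
  have univ: "{f \<in> ?H. pade_universal F \<Omega> f} = (\<Inter>m. U m)"
    using pade_universal_iff[OF assms(1)] by (auto simp: U_def)
  have U: "hol_open \<Omega> (U m)" for m
  proof -
    have "U m = (\<Union>(p, q)\<in>F. {f \<in> ?H. pade_close p q (exhaust_compact \<Omega> m) (1 / real (Suc m)) f})"
      by (auto simp: U_def)
    moreover have "openin ?X (\<Union>(p, q)\<in>F. {f \<in> ?H. pade_close p q (exhaust_compact \<Omega> m) (1 / real (Suc m)) f})"
      using hol_open_pade_close[OF assms(1) compact_exhaust_compact exhaust_compact_subset]
      by (intro openin_Union) (auto simp: openin_hol_topology)
    ultimately show ?thesis
      by (simp add: openin_hol_topology)
  qed
  have dense: "V \<inter> U m \<noteq> {}" if "hol_open \<Omega> V" "V \<noteq> {}" for V m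
  proof -
    have "1 / real (Suc m) > 0"
      by simp
    from pade_close_dense[OF assms that exhaust_compact_subset[of \<Omega> m] this] obtain f p q
      where f: "f \<in> V" "(p, q) \<in> F" "pade_close p q (exhaust_compact \<Omega> m) (1 / real (Suc m)) f"
      by blast
    moreover have "f \<in> ?H"
      using f(1) that(1) by (auto simp: hol_open_def)
    ultimately show ?thesis
      unfolding U_def by blast
  qed
  \<comment> \<open>Arbitrary \<open>W\<close> yields density; the whole space as \<open>W\<close>
    yields existence.\<close>
  have Baire: "\<exists>f\<in>W. pade_universal F \<Omega> f \<and> f \<in> ?H" if W: "hol_open \<Omega> W" "W \<noteq> {}" for W
  proof -
    have "\<exists>f\<in>W. \<forall>n. f \<in> U n"
      by (rule hol_space_Baire[OF assms(1) U _ W]) (rule dense)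
    then obtain f where f: "f \<in> W" "\<forall>n. f \<in> U n"
      by blast
    then have "f \<in> {f \<in> ?H. pade_universal F \<Omega> f}"
      unfolding univ by simp
    with f(1) show ?thesis
      by blast
  qed
  have "gdelta_in ?X (\<Inter>(range U))"
    using U by (intro gdelta_in_Inter) (auto intro: open_imp_gdelta_in simp: openin_hol_topology)
  moreover have "?X closure_of {f \<in> ?H. pade_universal F \<Omega> f} = ?H"
    using Baire by (auto simp: closure_of_def topspace_hol_topology openin_hol_topology)
  moreover have "\<exists>f\<in>?H. pade_universal F \<Omega> f"
  proof -
    have "hol_open \<Omega> ?H"
      using openin_topspace[of ?X] by (simp add: topspace_hol_topology openin_hol_topology)
    \<comment> \<open>The zero function, cut off outside \<Omega> to be extensional, shows that the
      space is nonempty.\<close>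
    moreover have "restrict (\<lambda>z. 0) \<Omega> \<in> ?H"
      by (auto simp: hol_space_def intro: holomorphic_transform[of "\<lambda>z. 0"])
    ultimately show ?thesis
      using Baire by blast
  qed
  ultimately show ?thesis
    using univ by simp
qed

end
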